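(* Let $G=(V,E,r,s)$ be a directed graph. Then the mapping $T$ from the set of all special congruences on $\mathrm{Inv}(G)$ to the set of all congruence pairs of $G$, and the mapping $\wp$ from the set of all congruence pairs of $G$ to the set of all special congruences on $\mathrm{Inv}(G)$, are inverse to each other. In particular, there exists a one-to-one correspondence between special congruences on $\mathrm{Inv}(G)$ and congruence pairs of $G$.
   Context: A directed graph $G=(V,E,r,s)$ consists of sets $V$ (vertices), $E$ (edges) and functions $r,s:E\to V$ (range and source). The index of a vertex $v$ is $|s^{-1}(v)|$. The graph inverse semigroup $\mathrm{Inv}(G)$ is the semigroup with zero generated by $V$, $E$ and $E^*=\{e^*: e\in E\}$ subject to, for all $u,v\in V$, $e,f\in E$: $uv=\delta_{u,v}u$; $s(e)e=er(e)=e$; $r(e)e^*=e^*s(e)=e^*$; $f^*e=\delta_{f,e}r(e)$. A path is a sequence $\alpha=e_1\cdots e_n$ ($n\ge1$) of edges with $r(e_i)=s(e_{i+1})$; $s(\alpha)=s(e_1)$, $r(\alpha)=r(e_n)$, $\alpha^*=e_n^*\cdots e_1^*$. A vertex $v$ is a path of length $0$ with $s(v)=r(v)=v$, $v^*=v$. Every nonzero element of $\mathrm{Inv}(G)$ is uniquely $\alpha\beta^*$ with $\alpha,\beta$ paths, $r(\alpha)=r(\beta)$. A path $e_1\cdots e_n$ ($n\ge 1$) is a cycle if $s(e_1)=r(e_n)$ and $s(e_i)\ne s(e_j)$ for $i\ne j$; its vertices are $s(e_1),\dots,s(e_n)$. A congruence on $\mathrm{Inv}(G)$ is special if no vertex is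 equivalent to $0$. Let $\bar V=\{v\in V: |s^{-1}(v)|=1\}$; for $v\in\bar V$ let $e_v$ be the unique edge in $s^{-1}(v)$. For $W\subseteq\bar V$ let $\mathrm{C}(W)$ be the set of all cycles whose vertices all lie in $W$. A cycle function is a function $f:\mathrm{C}(W)\to\mathbb{Z}^+\cup\{\infty\}$ invariant under cyclic permutations of cycles ($\mathbb Z^+$ is the set of positive integers). A congruence pair $(W,f)$ of $G$ consists of a subset $W\subseteq\bar V$ and a cycle function $f:\mathrm{C}(W)\to\mathbb{Z}^+\cup\{\infty\}$. Mapping $T$: for a special congruence $\rho$, $T(\rho)=(W,f)$ where $W=\{v\in V: ee^*\,\rho\, v\text{ for some } e\in s^{-1}(v)\}$ (all such vertices have index one), and for $c\in \mathrm{C}(W)$, $f(c)$ is the smallest positive integer $m$ with $c^m\,\rho\, s(c)$, or $f(c)=\infty$ if no such $m$ exists. Mapping $\wp$: for a congruence pair $(W,f)$, $\wp(W,f)$ is the congruence on $\mathrm{Inv}(G)$ generated by all pairs $(e_ve_v^*,v)$ for $v\in W$ and $(c^{f(c)},s(c))$ for $c\in\mathrm{C}(W)$ with $f(c)\in\mathbb{Z}^+$. *)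

theory Defs
  imports
    "Graph_Theory.Arc_Walk"
    "HOL-Library.Extended_Nat"
    "HOL-Library.FuncSet"
begin

section \<open>Semigroup congruences\<close>

definition semigroup_congruence ::
    "'a set \<Rightarrow> ('a \<Rightarrow> 'a \<Rightarrow> 'a) \<Rightarrow> ('a \<times> 'a) set \<Rightarrow> bool" where
  "semigroup_congruence S mul \<rho> \<longleftrightarrow>
     equiv S \<rho> \<and>
     (\<forall>(x, y)\<in>\<rho>. \<forall>z\<in>S. (mul z x, mul z y) \<in> \<rho> \<and> (mul x z, mul y z) \<in> \<rho>)"

definition generated_congruence ::
    "'a set \<Rightarrow> ('a \<Rightarrow> 'a \<Rightarrow> 'a) \<Rightarrow> ('a \<times> 'a) set \<Rightarrow> ('a \<times> 'a) set" where
  "generated_congruence S mul R = \<Inter> {\<rho>. semigroup_congruence S mul \<rho> \<and> R \<subseteq> \<rho>}"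

text \<open>The product in the quotient by a congruence \<open>\<rho>\<close>; elements of the quotient are
  the classes in \<open>S // \<rho>\<close>.\<close>

definition quotient_mult ::
    "('a \<Rightarrow> 'a \<Rightarrow> 'a) \<Rightarrow> ('a \<times> 'a) set \<Rightarrow> 'a set \<Rightarrow> 'a set \<Rightarrow> 'a set" where
  "quotient_mult mul \<rho> X Y = (\<Union>x\<in>X. \<Union>y\<in>Y. \<rho> `` {mul x y})"

text \<open>The \<open>n\<close>-th power in a semigroup without identity, meaningful only for \<open>n \<ge> 1\<close>.\<close>

definition semigroup_power :: "('a \<Rightarrow> 'a \<Rightarrow> 'a) \<Rightarrow> 'a \<Rightarrow> nat \<Rightarrow> 'a" where
  "semigroup_power mul x n = (mul x ^^ (n - 1)) x"


section \<open>The graph inverse semigroup\<close>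

text \<open>A directed graph is a \<open>wf_digraph\<close>: \<open>tail G\<close> is the source map $s$ and \<open>head G\<close> the
  range map $r$. Loops, multiple edges, and infinite vertex and edge sets are allowed.\<close>

datatype ('v, 'e) generator = Vert 'v | Edge 'e | Star 'e

text \<open>The free semigroup with zero on the generators: \<open>None\<close> is the zero, \<open>Some w\<close> with
  \<open>w \<noteq> []\<close> a word.\<close>

type_synonym ('v, 'e) word0 = "('v, 'e) generator list option"

definition generators :: "('v, 'e) pre_digraph \<Rightarrow> ('v, 'e) generator set" where
  "generators G = Vert ` verts G \<union> Edge ` arcs G \<union> Star ` arcs G"

definition words0 :: "('v, 'e) pre_digraph \<Rightarrow> ('v, 'e) word0 set" where
  "words0 G = insert None {Some w | w. w \<noteq> [] \<and> set w \<subseteq> generators G}"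

fun word0_mult :: "('v, 'e) word0 \<Rightarrow> ('v, 'e) word0 \<Rightarrow> ('v, 'e) word0" where
  "word0_mult (Some u) (Some w) = Some (u @ w)"
| "word0_mult _ _ = None"

definition defining_relations ::
    "('v, 'e) pre_digraph \<Rightarrow> (('v, 'e) word0 \<times> ('v, 'e) word0) set" where
  "defining_relations G =
     {(Some [Vert u, Vert v], if u = v then Some [Vert u] else None) | u v.
        u \<in> verts G \<and> v \<in> verts G} \<union>
     {(Some [Vert (tail G e), Edge e], Some [Edge e]) | e. e \<in> arcs G} \<union>
     {(Some [Edge e, Vert (head G e)], Some [Edge e]) | e. e \<in> arcs G} \<union>
     {(Some [Vert (head G e), Star e], Some [Star e]) | e. e \<in> arcs G} \<union>
     {(Some [Star e, Vert (tail G e)], Some [Star e]) | e. e \<in> arcs G} \<union>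
     {(Some [Star f, Edge e], if f = e then Some [Vert (head G e)] else None) | e f.
        e \<in> arcs G \<and> f \<in> arcs G}"

definition inv_rel :: "('v, 'e) pre_digraph \<Rightarrow> (('v, 'e) word0 \<times> ('v, 'e) word0) set" where
  "inv_rel G = generated_congruence (words0 G) word0_mult (defining_relations G)"

type_synonym ('v, 'e) inv_elem = "('v, 'e) word0 set"

definition inv_carrier :: "('v, 'e) pre_digraph \<Rightarrow> ('v, 'e) inv_elem set" where
  "inv_carrier G = words0 G // inv_rel G"

definition inv_mult ::
    "('v, 'e) pre_digraph \<Rightarrow> ('v, 'e) inv_elem \<Rightarrow> ('v, 'e) inv_elem \<Rightarrow> ('v, 'e) inv_elem" where
  "inv_mult G = quotient_mult word0_mult (inv_rel G)"

definition inv_zero :: "('v, 'e) pre_digraph \<Rightarrow> ('v, 'e) inv_elem" where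
  "inv_zero G = inv_rel G `` {None}"

definition inv_word :: "('v, 'e) pre_digraph \<Rightarrow> ('v, 'e) generator list \<Rightarrow> ('v, 'e) inv_elem" where
  "inv_word G w = inv_rel G `` {Some w}"

abbreviation inv_vert :: "('v, 'e) pre_digraph \<Rightarrow> 'v \<Rightarrow> ('v, 'e) inv_elem" where
  "inv_vert G v \<equiv> inv_word G [Vert v]"

abbreviation inv_edge :: "('v, 'e) pre_digraph \<Rightarrow> 'e \<Rightarrow> ('v, 'e) inv_elem" where
  "inv_edge G e \<equiv> inv_word G [Edge e]"

abbreviation inv_star :: "('v, 'e) pre_digraph \<Rightarrow> 'e \<Rightarrow> ('v, 'e) inv_elem" where
  "inv_star G e \<equiv> inv_word G [Star e]"

text \<open>The element $e_1 \cdots e_n$ given by a nonempty path.\<close>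

abbreviation inv_path :: "('v, 'e) pre_digraph \<Rightarrow> 'e list \<Rightarrow> ('v, 'e) inv_elem" where
  "inv_path G p \<equiv> inv_word G (map Edge p)"

definition special_congruences ::
    "('v, 'e) pre_digraph \<Rightarrow> (('v, 'e) inv_elem \<times> ('v, 'e) inv_elem) set set" where
  "special_congruences G =
     {\<rho>. semigroup_congruence (inv_carrier G) (inv_mult G) \<rho> \<and>
          (\<forall>v\<in>verts G. (inv_vert G v, inv_zero G) \<notin> \<rho>)}"


section \<open>Cycles and congruence pairs\<close>

abbreviation path_source :: "('v, 'e) pre_digraph \<Rightarrow> 'e list \<Rightarrow> 'v" where
  "path_source G p \<equiv> tail G (hd p)"

abbreviation path_range :: "('v, 'e) pre_digraph \<Rightarrow> 'e list \<Rightarrow> 'v" where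
  "path_range G p \<equiv> head G (last p)"

definition is_cycle :: "('v, 'e) pre_digraph \<Rightarrow> 'e list \<Rightarrow> bool" where
  "is_cycle G c \<longleftrightarrow>
     c \<noteq> [] \<and> pre_digraph.awalk G (path_source G c) c (path_range G c) \<and>
     path_source G c = path_range G c \<and> distinct (map (tail G) c)"

definition index_one_verts :: "('v, 'e) pre_digraph \<Rightarrow> 'v set" where
  "index_one_verts G = {v \<in> verts G. card (out_arcs G v) = 1}"

definition the_out_arc :: "('v, 'e) pre_digraph \<Rightarrow> 'v \<Rightarrow> 'e" where
  "the_out_arc G v = (THE e. e \<in> out_arcs G v)"

definition cycles_in :: "('v, 'e) pre_digraph \<Rightarrow> 'v set \<Rightarrow> 'e list set" where
  "cycles_in G W = {c. is_cycle G c \<and> tail G ` set c \<subseteq> W}"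

text \<open>Cycle functions are extensional, i.e. \<open>undefined\<close> outside their domain, so that equality
  in HOL is equality of functions on \<open>cycles_in G W\<close>.\<close>

definition cycle_functions :: "('v, 'e) pre_digraph \<Rightarrow> 'v set \<Rightarrow> ('e list \<Rightarrow> enat) set" where
  "cycle_functions G W =
     {f \<in> cycles_in G W \<rightarrow>\<^sub>E {n. n \<noteq> 0}. \<forall>c\<in>cycles_in G W. \<forall>k. f (rotate k c) = f c}"

definition congruence_pairs :: "('v, 'e) pre_digraph \<Rightarrow> ('v set \<times> ('e list \<Rightarrow> enat)) set" where
  "congruence_pairs G = {(W, f). W \<subseteq> index_one_verts G \<and> f \<in> cycle_functions G W}"


section \<open>The two mappings\<close>

definition cong_verts ::
    "('v, 'e) pre_digraph \<Rightarrow> (('v, 'e) inv_elem \<times> ('v, 'e) inv_elem) set \<Rightarrow> 'v set" where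
  "cong_verts G \<rho> =
     {v \<in> verts G. \<exists>e\<in>out_arcs G v.
        (inv_mult G (inv_edge G e) (inv_star G e), inv_vert G v) \<in> \<rho>}"

definition cycle_order ::
    "('v, 'e) pre_digraph \<Rightarrow> (('v, 'e) inv_elem \<times> ('v, 'e) inv_elem) set \<Rightarrow> 'e list \<Rightarrow> enat" where
  "cycle_order G \<rho> c =
     (let P = (\<lambda>m::nat. m > 0 \<and>
                 (semigroup_power (inv_mult G) (inv_path G c) m, inv_vert G (path_source G c)) \<in> \<rho>)
      in if \<exists>m. P m then enat (LEAST m. P m) else \<infinity>)"

definition map_T ::
    "('v, 'e) pre_digraph \<Rightarrow> (('v, 'e) inv_elem \<times> ('v, 'e) inv_elem) set \<Rightarrow>
     'v set \<times> ('e list \<Rightarrow> enat)" where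
  "map_T G \<rho> = (let W = cong_verts G \<rho> in (W, restrict (cycle_order G \<rho>) (cycles_in G W)))"

definition map_wp ::
    "('v, 'e) pre_digraph \<Rightarrow> 'v set \<times> ('e list \<Rightarrow> enat) \<Rightarrow>
     (('v, 'e) inv_elem \<times> ('v, 'e) inv_elem) set" where
  "map_wp G = (\<lambda>(W, f). generated_congruence (inv_carrier G) (inv_mult G)
     ({(inv_mult G (inv_edge G (the_out_arc G v)) (inv_star G (the_out_arc G v)), inv_vert G v)
         | v. v \<in> W} \<union>
      {(semigroup_power (inv_mult G) (inv_path G c) m, inv_vert G (path_source G c))
         | c m. c \<in> cycles_in G W \<and> f c = enat m}))"

end

(* A special congruence never identifies a nonzero element with zero. If
   alpha beta^* and gamma delta^* are equivalent, then alpha and gamma start at the same vertex and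
   are prefix-comparable, and so are beta and delta; cancelling common prefixes leaves a relation
   between a vertex and some gamma delta^*, or between beta^* and gamma. In either case all vertices
   involved lie in W, where paths are deterministic, so the relation follows from
   e_v e_v^* ~ v and from a relation c^k ~ s(c) for a cycle c, whose exponents are the multiples of
   the least one. Hence a special congruence is generated by its congruence pair.
   Conversely, to see that wp(W, f) identifies no more than intended, Inv(G) is represented by
   relations on pairs (xi, g), where xi is an infinite path (with a loop added at each vertex outside
   W) and g is an integer, taken modulo f(c) |c| if xi ends in a cycle c of finite order. *)

theory Submission
  imports Defs "HOL-Library.Sublist"
begin

text \<open>Cancelling common prefixes is possible in every congruence because alpha^* alpha =
  r(alpha): multiplying by alpha^* on the left and by beta on the right undoes the prefixes alpha
  and beta, and multiplying back restores them. So a special congruence can be compared with any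
  second congruence that is only known to contain the relations given by the pair. For the converse,
  an action on plain infinite paths would have two defects. If v has index one, then e_v e_v^* and v
  act alike even when v lies outside W; the added loop supplies a ray at v that does not begin with
  e_v, and it also gives sinks a ray. Moreover, a cycle fixes the ray that repeats it, so every
  order would look like 1; the integer detects the power. It counts edges and not turns, so that
  each edge acts by the same rule of adding 1, which is why the modulus is f(c) times the length of
  c. If no cycle of finite order is involved, the modulus is 0 and integers are compared
  exactly.\<close>

section \<open>Generated congruences\<close>

lemma semigroup_congruenceI:
  assumes "equiv S \<rho>"
    and "\<And>x y z. (x, y) \<in> \<rho> \<Longrightarrow> z \<in> S \<Longrightarrow> (mul z x, mul z y) \<in> \<rho>"
    and "\<And>x y z. (x, y) \<in> \<rho> \<Longrightarrow> z \<in> S \<Longrightarrow> (mul x z, mul y z) \<in> \<rho>"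
  shows "semigroup_congruence S mul \<rho>"
  using assms unfolding semigroup_congruence_def by auto

lemma semigroup_congruenceD:
  assumes "semigroup_congruence S mul \<rho>"
  shows "equiv S \<rho>"
    and "(x, y) \<in> \<rho> \<Longrightarrow> z \<in> S \<Longrightarrow> (mul z x, mul z y) \<in> \<rho>"
    and "(x, y) \<in> \<rho> \<Longrightarrow> z \<in> S \<Longrightarrow> (mul x z, mul y z) \<in> \<rho>"
  using assms unfolding semigroup_congruence_def by auto

lemma generated_congruence_superset: "R \<subseteq> generated_congruence S mul R"
  unfolding generated_congruence_def by auto

lemma generated_congruence_least:
  "semigroup_congruence S mul \<rho> \<Longrightarrow> R \<subseteq> \<rho> \<Longrightarrow> generated_congruence S mul R \<subseteq> \<rho>"
  unfolding generated_congruence_def by auto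

lemma semigroup_congruence_generated:
  assumes closed: "\<And>x y. x \<in> S \<Longrightarrow> y \<in> S \<Longrightarrow> mul x y \<in> S" and R: "R \<subseteq> S \<times> S"
  shows "semigroup_congruence S mul (generated_congruence S mul R)"
proof (rule semigroup_congruenceI)
  let ?C = "{\<rho>. semigroup_congruence S mul \<rho> \<and> R \<subseteq> \<rho>}"
  \<comment> \<open>The universal relation on S belongs to the family. This keeps the intersection
    from being taken over the empty family and bounds it by S x S.\<close>
  have univ: "S \<times> S \<in> ?C"
    using R closed by (auto intro!: semigroup_congruenceI equivI refl_onI symI transI)
  have eq: "equiv S \<rho>" if "\<rho> \<in> ?C" for \<rho>
    using that by (auto dest: semigroup_congruenceD)
  show "equiv S (generated_congruence S mul R)"
    unfolding generated_congruence_def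
  proof (rule equivI)
    show "\<Inter> ?C \<subseteq> S \<times> S" using univ by blast
    show "refl_on S (\<Inter> ?C)" using eq by (force simp: equiv_def refl_on_def)
    show "sym (\<Inter> ?C)"
      using eq by (intro symI InterI) (metis InterD equivE symD)
    show "trans (\<Inter> ?C)"
      using eq by (intro transI InterI) (metis InterD equivE transD)
  qed
qed (auto simp: generated_congruence_def dest: semigroup_congruenceD)

section \<open>Congruences on words and on the graph inverse semigroup\<close>

lemma in_generators [simp]:
  "Vert v \<in> generators G \<longleftrightarrow> v \<in> verts G"
  "Edge e \<in> generators G \<longleftrightarrow> e \<in> arcs G"
  "Star e \<in> generators G \<longleftrightarrow> e \<in> arcs G"
  by (auto simp: generators_def)

lemma in_words0 [simp]:
  "None \<in> words0 G"
  "Some w \<in> words0 G \<longleftrightarrow> w \<noteq> [] \<and> set w \<subseteq> generators G"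
  by (auto simp: words0_def)

lemma word0_mult_None [simp]: "word0_mult x None = None" "word0_mult None x = None"
  by (cases x; simp)+

lemma word0_mult_closed: "x \<in> words0 G \<Longrightarrow> y \<in> words0 G \<Longrightarrow> word0_mult x y \<in> words0 G"
  by (cases x; cases y) auto

abbreviation inv_class :: "('v, 'e) pre_digraph \<Rightarrow> ('v, 'e) word0 \<Rightarrow> ('v, 'e) inv_elem" where
  "inv_class G x \<equiv> inv_rel G `` {x}"

text \<open>Congruences on the quotient semigroup correspond to the congruences on words that
  contain the defining relations. Calculations are made on the word side, where elements are lists
  instead of classes.\<close>

definition word_pullback ::
    "('v, 'e) pre_digraph \<Rightarrow> (('v, 'e) inv_elem \<times> ('v, 'e) inv_elem) set \<Rightarrow>
     (('v, 'e) word0 \<times> ('v, 'e) word0) set" where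
  "word_pullback G \<rho> = {(x, y) \<in> words0 G \<times> words0 G. (inv_class G x, inv_class G y) \<in> \<rho>}"

definition word_pushforward ::
    "('v, 'e) pre_digraph \<Rightarrow> (('v, 'e) word0 \<times> ('v, 'e) word0) set \<Rightarrow>
     (('v, 'e) inv_elem \<times> ('v, 'e) inv_elem) set" where
  "word_pushforward G R = (\<lambda>(x, y). (inv_class G x, inv_class G y)) ` R"

locale word_congruence = wf_digraph G for G :: "('v, 'e) pre_digraph" +
  fixes R :: "(('v, 'e) word0 \<times> ('v, 'e) word0) set"
  assumes cong: "semigroup_congruence (words0 G) word0_mult R"
    and relations: "defining_relations G \<subseteq> R"

lemma (in wf_digraph) word_congruence_inv_rel: "word_congruence G (inv_rel G)"
proof
  have "defining_relations G \<subseteq> words0 G \<times> words0 G"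
    by (auto simp: defining_relations_def)
  then show "semigroup_congruence (words0 G) word0_mult (inv_rel G)"
    unfolding inv_rel_def by (intro semigroup_congruence_generated word0_mult_closed)
  show "defining_relations G \<subseteq> inv_rel G"
    unfolding inv_rel_def by (rule generated_congruence_superset)
qed

context word_congruence
begin

lemma equiv: "equiv (words0 G) R"
  by (rule semigroup_congruenceD[OF cong])

lemma inv_rel_subset: "inv_rel G \<subseteq> R"
  unfolding inv_rel_def by (rule generated_congruence_least[OF cong relations])

lemma mult_cong:
  assumes "(x, x') \<in> R" "(y, y') \<in> R"
  shows "(word0_mult x y, word0_mult x' y') \<in> R"
proof -
  have "y \<in> words0 G" "x' \<in> words0 G"
    using assms equiv_type[OF equiv] by auto
  then have "(word0_mult x y, word0_mult x' y) \<in> R" "(word0_mult x' y, word0_mult x' y') \<in> R"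
    using semigroup_congruenceD(2,3)[OF cong] assms by auto
  then show ?thesis
    using equiv by (meson equivE transD)
qed

lemma quotient_mult_class:
  assumes "x \<in> words0 G" "y \<in> words0 G"
  shows "quotient_mult word0_mult R (R `` {x}) (R `` {y}) = R `` {word0_mult x y}"
proof -
  have *: "R `` {word0_mult x' y'} = R `` {word0_mult x y}" if "x' \<in> R `` {x}" "y' \<in> R `` {y}" for x' y'
    using that mult_cong[of x x' y y'] equiv_class_eq[OF equiv] by auto
  have "x \<in> R `` {x}" "y \<in> R `` {y}"
    using assms equiv_class_self[OF equiv] by blast+
  then show ?thesis
    unfolding quotient_mult_def using * by blast
qed

end

context wf_digraph
begin

lemma inv_class_in_carrier [simp]: "x \<in> words0 G \<Longrightarrow> inv_class G x \<in> inv_carrier G"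
  unfolding inv_carrier_def by (rule quotientI)

lemma inv_carrierE:
  assumes "X \<in> inv_carrier G"
  obtains x where "x \<in> words0 G" "X = inv_class G x"
  using assms unfolding inv_carrier_def by (rule quotientE)

lemma inv_mult_class [simp]:
  "x \<in> words0 G \<Longrightarrow> y \<in> words0 G \<Longrightarrow>
    inv_mult G (inv_class G x) (inv_class G y) = inv_class G (word0_mult x y)"
  unfolding inv_mult_def by (rule word_congruence.quotient_mult_class[OF word_congruence_inv_rel])

lemma inv_mult_word [simp]:
  "u \<noteq> [] \<Longrightarrow> set u \<subseteq> generators G \<Longrightarrow> w \<noteq> [] \<Longrightarrow> set w \<subseteq> generators G \<Longrightarrow>
    inv_mult G (inv_word G u) (inv_word G w) = inv_word G (u @ w)"
  unfolding inv_word_def by simp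

lemma inv_mult_closed: "X \<in> inv_carrier G \<Longrightarrow> Y \<in> inv_carrier G \<Longrightarrow> inv_mult G X Y \<in> inv_carrier G"
  by (auto elim!: inv_carrierE simp: word0_mult_closed)

lemma word_pullback_iff:
  "(x, y) \<in> word_pullback G \<rho> \<longleftrightarrow>
    x \<in> words0 G \<and> y \<in> words0 G \<and> (inv_class G x, inv_class G y) \<in> \<rho>"
  by (simp add: word_pullback_def)

lemma inv_class_eqI: "(x, y) \<in> inv_rel G \<Longrightarrow> inv_class G x = inv_class G y"
  using equiv_class_eq[OF word_congruence.equiv[OF word_congruence_inv_rel]] .

lemma inv_class_eqD: "inv_class G x = inv_class G y \<Longrightarrow> y \<in> words0 G \<Longrightarrow> (x, y) \<in> inv_rel G"
  using eq_equiv_class[OF _ word_congruence.equiv[OF word_congruence_inv_rel]] .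

lemma word_congruence_pullback:
  assumes "semigroup_congruence (inv_carrier G) (inv_mult G) \<rho>"
  shows "word_congruence G (word_pullback G \<rho>)"
proof
  note \<rho> = semigroup_congruenceD[OF assms]
  have eq: "refl_on (inv_carrier G) \<rho>" "sym \<rho>" "trans \<rho>"
    using \<rho>(1) by (auto elim: equivE)
  show "semigroup_congruence (words0 G) word0_mult (word_pullback G \<rho>)"
  proof (rule semigroup_congruenceI)
    show "equiv (words0 G) (word_pullback G \<rho>)"
    proof (rule equivI)
      show "refl_on (words0 G) (word_pullback G \<rho>)"
        using eq(1) by (auto simp: word_pullback_iff refl_on_def)
      show "sym (word_pullback G \<rho>)"
        using eq(2) by (auto simp: word_pullback_iff sym_def)
      show "trans (word_pullback G \<rho>)"
        using eq(3) unfolding trans_def word_pullback_iff by blast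
    qed (auto simp: word_pullback_def)
  next
    fix x y z assume xy: "(x, y) \<in> word_pullback G \<rho>" and z: "z \<in> words0 G"
    then have "(inv_mult G (inv_class G z) (inv_class G x), inv_mult G (inv_class G z) (inv_class G y)) \<in> \<rho>"
      "(inv_mult G (inv_class G x) (inv_class G z), inv_mult G (inv_class G y) (inv_class G z)) \<in> \<rho>"
      by (auto intro!: \<rho>(2,3) simp: word_pullback_iff simp del: inv_mult_class)
    then show "(word0_mult z x, word0_mult z y) \<in> word_pullback G \<rho>"
      "(word0_mult x z, word0_mult y z) \<in> word_pullback G \<rho>"
      using xy z by (auto simp: word_pullback_iff word0_mult_closed)
  qed
  show "defining_relations G \<subseteq> word_pullback G \<rho>"
  proof
    interpret I: word_congruence G "inv_rel G" by (rule word_congruence_inv_rel)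
    fix p assume "p \<in> defining_relations G"
    then obtain x y where p: "p = (x, y)" and xy: "(x, y) \<in> inv_rel G"
      using I.relations by (cases p) auto
    then show "p \<in> word_pullback G \<rho>"
      using equiv_type[OF I.equiv] inv_class_eqI[OF xy] eq(1)
      by (auto simp: word_pullback_iff refl_on_def)
  qed
qed

text \<open>Since \<open>R\<close> contains \<open>inv_rel G\<close>, whether two classes are
  related does not depend on the representatives. The equivalence in the second claim expresses
  this, and the first claim is reduced to properties of \<open>R\<close> by it.\<close>

lemma semigroup_congruence_pushforward:
  assumes "word_congruence G R"
  shows "semigroup_congruence (inv_carrier G) (inv_mult G) (word_pushforward G R)"
    and "x \<in> words0 G \<Longrightarrow> y \<in> words0 G \<Longrightarrow>
      (inv_class G x, inv_class G y) \<in> word_pushforward G R \<longleftrightarrow> (x, y) \<in> R"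
proof -
  interpret word_congruence G R by fact
  have R: "R \<subseteq> words0 G \<times> words0 G" "refl_on (words0 G) R" "sym R" "trans R"
    using equiv by (auto elim: equivE)
  have iff: "(inv_class G x, inv_class G y) \<in> word_pushforward G R \<longleftrightarrow> (x, y) \<in> R"
    if "x \<in> words0 G" "y \<in> words0 G" for x y
  proof
    assume "(inv_class G x, inv_class G y) \<in> word_pushforward G R"
    then obtain x' y' where *: "inv_class G x = inv_class G x'" "inv_class G y = inv_class G y'"
      "(x', y') \<in> R"
      by (auto simp: word_pushforward_def)
    then have "(x, x') \<in> R" "(y, y') \<in> R"
      using inv_class_eqD inv_rel_subset R(1) by blast+
    then show "(x, y) \<in> R"
      using *(3) R(3,4) by (meson symD transD)
  qed (auto simp: word_pushforward_def)
  then show "x \<in> words0 G \<Longrightarrow> y \<in> words0 G \<Longrightarrow>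
      (inv_class G x, inv_class G y) \<in> word_pushforward G R \<longleftrightarrow> (x, y) \<in> R" .
  have sub: "word_pushforward G R \<subseteq> inv_carrier G \<times> inv_carrier G"
    using R(1) by (auto simp: word_pushforward_def)
  show "semigroup_congruence (inv_carrier G) (inv_mult G) (word_pushforward G R)"
  proof (rule semigroup_congruenceI)
    show "equiv (inv_carrier G) (word_pushforward G R)"
    proof (rule equivI)
      show "refl_on (inv_carrier G) (word_pushforward G R)"
        using R(2) by (auto simp: iff refl_on_def elim!: inv_carrierE)
      show "sym (word_pushforward G R)"
        using R(3) by (intro symI) (force simp: word_pushforward_def dest: symD)
      show "trans (word_pushforward G R)"
      proof (rule transI)
        fix X Y Z assume XY: "(X, Y) \<in> word_pushforward G R" and YZ: "(Y, Z) \<in> word_pushforward G R"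
        have "X \<in> inv_carrier G" "Y \<in> inv_carrier G" "Z \<in> inv_carrier G"
          using XY YZ sub by auto
        then obtain x y z where [simp]: "X = inv_class G x" "Y = inv_class G y" "Z = inv_class G z"
          and "x \<in> words0 G" "y \<in> words0 G" "z \<in> words0 G"
          by (metis inv_carrierE)
        then show "(X, Z) \<in> word_pushforward G R"
          using XY YZ R(4) by (auto simp: iff dest: transD)
      qed
    qed (rule sub)
  next
    fix X Y Z assume XY: "(X, Y) \<in> word_pushforward G R" and Z: "Z \<in> inv_carrier G"
    have "X \<in> inv_carrier G" "Y \<in> inv_carrier G" "Z \<in> inv_carrier G"
      using XY Z sub by auto
    then obtain x y z where [simp]: "X = inv_class G x" "Y = inv_class G y" "Z = inv_class G z"
      and "x \<in> words0 G" "y \<in> words0 G" "z \<in> words0 G"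
      by (metis inv_carrierE)
    then show "(inv_mult G Z X, inv_mult G Z Y) \<in> word_pushforward G R"
      "(inv_mult G X Z, inv_mult G Y Z) \<in> word_pushforward G R"
      using XY semigroup_congruenceD(2,3)[OF cong]
      by (auto simp: iff word0_mult_closed)
  qed
qed

end

section \<open>Normal forms\<close>

lemma image_subset_generators [simp]:
  "Edge ` A \<subseteq> generators G \<longleftrightarrow> A \<subseteq> arcs G" "Star ` A \<subseteq> generators G \<longleftrightarrow> A \<subseteq> arcs G"
  by auto

context wf_digraph
begin

lemma awalkD:
  assumes "awalk u p v"
  shows "set p \<subseteq> arcs G" "u \<in> verts G" "v \<in> verts G"
  using assms by auto

text \<open>The midpoint of a concatenated walk is named by an existential, so that
  \<open>auto\<close> can obtain it as a variable.\<close>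

lemma awalk_append_conv: "awalk u (p @ q) v \<longleftrightarrow> (\<exists>w. awalk u p w \<and> awalk w q v)"
  by (metis awalk_append_iff awalk_appendI)

declare awalk_append_iff [simp del]

end

text \<open>The element alpha beta^* with its common range u written in the middle. The vertex keeps
  the word nonempty, so paths of length 0 need no separate shape.\<close>

definition nf :: "'e list \<Rightarrow> 'v \<Rightarrow> 'e list \<Rightarrow> ('v, 'e) generator list" where
  "nf \<alpha> u \<beta> = map Edge \<alpha> @ Vert u # map Star (rev \<beta>)"

lemma nf_not_Nil [simp]: "nf \<alpha> u \<beta> \<noteq> []"
  by (simp add: nf_def)

lemma set_nf_subset [simp]:
  "set (nf \<alpha> u \<beta>) \<subseteq> generators G \<longleftrightarrow> set \<alpha> \<subseteq> arcs G \<and> u \<in> verts G \<and> set \<beta> \<subseteq> arcs G"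
  by (auto simp: nf_def)

section \<open>Calculation with words modulo a congruence\<close>

context word_congruence
begin

definition eqv :: "('v, 'e) generator list \<Rightarrow> ('v, 'e) generator list \<Rightarrow> bool" (infix "\<approx>" 50) where
  "u \<approx> w \<longleftrightarrow> (Some u, Some w) \<in> R"

definition vanishes :: "('v, 'e) generator list \<Rightarrow> bool" where
  "vanishes w \<longleftrightarrow> (Some w, None) \<in> R"

lemma eqv_refl: "w \<noteq> [] \<Longrightarrow> set w \<subseteq> generators G \<Longrightarrow> w \<approx> w"
  using equiv unfolding eqv_def by (auto simp: equiv_def refl_on_def)

lemma eqv_sym: "u \<approx> w \<Longrightarrow> w \<approx> u"
  using equiv unfolding eqv_def by (auto simp: equiv_def dest: symD)

lemma eqv_trans [trans]: "u \<approx> v \<Longrightarrow> v \<approx> w \<Longrightarrow> u \<approx> w"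
  using equiv unfolding eqv_def by (auto simp: equiv_def dest: transD)

lemma eqv_vanishes [trans]: "u \<approx> v \<Longrightarrow> vanishes v \<Longrightarrow> vanishes u"
  using equiv unfolding eqv_def vanishes_def by (auto simp: equiv_def dest: transD)

text \<open>Words form a semigroup without identity, so an empty context is not a multiplication and
  is treated by cases. Letting \<open>y\<close> be optional covers equivalence of words and
  equivalence to zero at once.\<close>

lemma word0_ctx:
  assumes "(Some u, y) \<in> R" and p: "set p \<subseteq> generators G" and q: "set q \<subseteq> generators G"
  shows "(Some (p @ u @ q), map_option (\<lambda>w. p @ w @ q) y) \<in> R"
proof -
  have 1: "(Some (u @ q), map_option (\<lambda>w. w @ q) y) \<in> R"
  proof (cases "q = []")
    case False
    have "word0_mult y (Some q) = map_option (\<lambda>w. w @ q) y" by (cases y) auto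
    then show ?thesis
      using semigroup_congruenceD(3)[OF cong assms(1), of "Some q"] q False by simp
  qed (use assms(1) in \<open>simp add: option.map_ident\<close>)
  show ?thesis
  proof (cases "p = []")
    case False
    have "word0_mult (Some p) (map_option (\<lambda>w. w @ q) y) = map_option (\<lambda>w. p @ w @ q) y"
      by (cases y) auto
    then show ?thesis
      using semigroup_congruenceD(2)[OF cong 1, of "Some p"] p False by simp
  qed (use 1 in simp)
qed

lemma ctx: "u \<approx> w \<Longrightarrow> set p \<subseteq> generators G \<Longrightarrow> set q \<subseteq> generators G \<Longrightarrow> p @ u @ q \<approx> p @ w @ q"
  using word0_ctx[of u "Some w" p q] by (simp add: eqv_def)

lemma vanishes_ctx:
  "vanishes u \<Longrightarrow> set p \<subseteq> generators G \<Longrightarrow> set q \<subseteq> generators G \<Longrightarrow> vanishes (p @ u @ q)"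
  using word0_ctx[of u None p q] by (simp add: vanishes_def)

lemma defining:
  "v \<in> verts G \<Longrightarrow> [Vert v, Vert v] \<approx> [Vert v]"
  "e \<in> arcs G \<Longrightarrow> [Vert (tail G e), Edge e] \<approx> [Edge e]"
  "e \<in> arcs G \<Longrightarrow> [Edge e, Vert (head G e)] \<approx> [Edge e]"
  "e \<in> arcs G \<Longrightarrow> [Vert (head G e), Star e] \<approx> [Star e]"
  "e \<in> arcs G \<Longrightarrow> [Star e, Vert (tail G e)] \<approx> [Star e]"
  "e \<in> arcs G \<Longrightarrow> [Star e, Edge e] \<approx> [Vert (head G e)]"
  unfolding eqv_def by (rule subsetD[OF relations], force simp: defining_relations_def)+

lemma defining_zero:
  "u \<in> verts G \<Longrightarrow> v \<in> verts G \<Longrightarrow> u \<noteq> v \<Longrightarrow> vanishes [Vert u, Vert v]"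
  "e \<in> arcs G \<Longrightarrow> f \<in> arcs G \<Longrightarrow> e \<noteq> f \<Longrightarrow> vanishes [Star f, Edge e]"
  unfolding vanishes_def by (rule subsetD[OF relations], force simp: defining_relations_def)+

text \<open>From s(e) e = e = e r(e), the vertex travels through the path one edge at a time. Stated
  as an exchange instead of an absorption, it includes the empty path.\<close>

lemma path_vert: "awalk a \<alpha> u \<Longrightarrow> Vert a # map Edge \<alpha> \<approx> map Edge \<alpha> @ [Vert u]"
proof (induction \<alpha> arbitrary: a)
  case Nil
  then show ?case by (auto simp: awalk_Nil_iff intro: eqv_refl)
next
  case (Cons e \<alpha>)
  then have e: "e \<in> arcs G" "a = tail G e" and \<alpha>: "awalk (head G e) \<alpha> u" "set \<alpha> \<subseteq> arcs G"
    by (auto simp: awalk_Cons_iff)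
  have "Vert a # map Edge (e # \<alpha>) \<approx> Edge e # map Edge \<alpha>"
    using ctx[OF defining(2), of e "[]" "map Edge \<alpha>"] e \<alpha> by simp
  also have "\<dots> \<approx> Edge e # Vert (head G e) # map Edge \<alpha>"
    using ctx[OF defining(3)[THEN eqv_sym], of e "[]" "map Edge \<alpha>"] e \<alpha> by simp
  also have "\<dots> \<approx> Edge e # map Edge \<alpha> @ [Vert u]"
    using ctx[OF Cons.IH[OF \<alpha>(1)], of "[Edge e]" "[]"] e \<alpha> by simp
  finally show ?case by simp
qed

lemma star_path_vert: "awalk b \<beta> u \<Longrightarrow> map Star (rev \<beta>) @ [Vert b] \<approx> Vert u # map Star (rev \<beta>)"
proof (induction \<beta> arbitrary: b)
  case Nil
  then show ?case by (auto simp: awalk_Nil_iff intro: eqv_refl)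
next
  case (Cons e \<beta>)
  then have e: "e \<in> arcs G" "b = tail G e" and \<beta>: "awalk (head G e) \<beta> u" "set \<beta> \<subseteq> arcs G"
    by (auto simp: awalk_Cons_iff)
  have "map Star (rev (e # \<beta>)) @ [Vert b] \<approx> map Star (rev \<beta>) @ [Star e]"
    using ctx[OF defining(5), of e "map Star (rev \<beta>)" "[]"] e \<beta> by simp
  also have "\<dots> \<approx> map Star (rev \<beta>) @ [Vert (head G e), Star e]"
    using ctx[OF defining(4)[THEN eqv_sym], of e "map Star (rev \<beta>)" "[]"] e \<beta> by simp
  also have "\<dots> \<approx> Vert u # map Star (rev \<beta>) @ [Star e]"
    using ctx[OF Cons.IH[OF \<beta>(1)], of "[]" "[Star e]"] e \<beta> by simp
  finally show ?case by simp
qed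

text \<open>The product telescopes from the middle by e^* e = r(e); the vertex left over by each
  cancellation starts the next one.\<close>

lemma star_path_cancel: "awalk a \<alpha> u \<Longrightarrow> map Star (rev \<alpha>) @ Vert a # map Edge \<alpha> \<approx> [Vert u]"
proof (induction \<alpha> arbitrary: a)
  case Nil
  then show ?case by (auto simp: awalk_Nil_iff intro: eqv_refl)
next
  case (Cons e \<alpha>)
  then have e: "e \<in> arcs G" "a = tail G e" and \<alpha>: "awalk (head G e) \<alpha> u" "set \<alpha> \<subseteq> arcs G"
    by (auto simp: awalk_Cons_iff)
  have "map Star (rev (e # \<alpha>)) @ Vert a # map Edge (e # \<alpha>) \<approx>
      map Star (rev \<alpha>) @ [Star e, Edge e] @ map Edge \<alpha>"
    using ctx[OF defining(2), of e "map Star (rev \<alpha>) @ [Star e]" "map Edge \<alpha>"] e \<alpha> by simp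
  also have "\<dots> \<approx> map Star (rev \<alpha>) @ [Vert (head G e)] @ map Edge \<alpha>"
    using e \<alpha> by (intro ctx defining) auto
  also have "\<dots> \<approx> [Vert u]"
    using Cons.IH \<alpha> by simp
  finally show ?case .
qed

lemma nf_absorb_left:
  assumes "awalk a \<alpha> u" "set \<beta> \<subseteq> arcs G"
  shows "Vert a # nf \<alpha> u \<beta> \<approx> nf \<alpha> u \<beta>"
proof -
  note w = awalkD[OF assms(1)]
  have "Vert a # nf \<alpha> u \<beta> \<approx> map Edge \<alpha> @ [Vert u, Vert u] @ map Star (rev \<beta>)"
    using ctx[OF path_vert[OF assms(1)], of "[]" "Vert u # map Star (rev \<beta>)"] w assms
    by (simp add: nf_def)
  also have "\<dots> \<approx> map Edge \<alpha> @ [Vert u] @ map Star (rev \<beta>)"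
    using w assms by (intro ctx defining) auto
  finally show ?thesis by (simp add: nf_def)
qed

lemma nf_absorb_right:
  assumes "awalk b \<beta> u" "set \<alpha> \<subseteq> arcs G"
  shows "nf \<alpha> u \<beta> @ [Vert b] \<approx> nf \<alpha> u \<beta>"
proof -
  note w = awalkD[OF assms(1)]
  have "nf \<alpha> u \<beta> @ [Vert b] \<approx> map Edge \<alpha> @ [Vert u, Vert u] @ map Star (rev \<beta>)"
    using ctx[OF star_path_vert[OF assms(1)], of "map Edge \<alpha> @ [Vert u]" "[]"] w assms
    by (simp add: nf_def)
  also have "\<dots> \<approx> map Edge \<alpha> @ [Vert u] @ map Star (rev \<beta>)"
    using w assms by (intro ctx defining) auto
  finally show ?thesis by (simp add: nf_def)
qed

lemma nf_cancel_left:
  assumes "awalk a \<alpha> m" "awalk m \<gamma> u" "set \<beta> \<subseteq> arcs G"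
  shows "map Star (rev \<alpha>) @ Vert a # nf (\<alpha> @ \<gamma>) u \<beta> \<approx> nf \<gamma> u \<beta>"
proof -
  have "map Star (rev \<alpha>) @ Vert a # nf (\<alpha> @ \<gamma>) u \<beta> \<approx> Vert m # nf \<gamma> u \<beta>"
    using ctx[OF star_path_cancel[OF assms(1)], of "[]" "nf \<gamma> u \<beta>"] awalkD[OF assms(2)] assms(3)
    by (simp add: nf_def)
  also have "\<dots> \<approx> nf \<gamma> u \<beta>"
    by (rule nf_absorb_left) fact+
  finally show ?thesis .
qed

lemma nf_cancel_right:
  assumes "awalk b \<beta> m" "awalk m \<delta> u" "set \<alpha> \<subseteq> arcs G"
  shows "nf \<alpha> u (\<beta> @ \<delta>) @ Vert b # map Edge \<beta> \<approx> nf \<alpha> u \<delta>"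
proof -
  have "nf \<alpha> u (\<beta> @ \<delta>) @ Vert b # map Edge \<beta> \<approx> nf \<alpha> u \<delta> @ [Vert m]"
    using ctx[OF star_path_cancel[OF assms(1)], of "nf \<alpha> u \<delta>" "[]"] awalkD[OF assms(2)] assms(3)
    by (simp add: nf_def)
  also have "\<dots> \<approx> nf \<alpha> u \<delta>"
    by (rule nf_absorb_right) fact+
  finally show ?thesis .
qed

lemma nf_cancel_both:
  assumes "awalk a \<alpha> m" "awalk b \<beta> n" "awalk m \<gamma> u" "awalk n \<delta> u"
  shows "(map Star (rev \<alpha>) @ [Vert a]) @ nf (\<alpha> @ \<gamma>) u (\<beta> @ \<delta>) @ Vert b # map Edge \<beta> \<approx> nf \<gamma> u \<delta>"
proof -
  have "(map Star (rev \<alpha>) @ [Vert a]) @ nf (\<alpha> @ \<gamma>) u (\<beta> @ \<delta>) @ Vert b # map Edge \<beta> \<approx>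
      nf \<gamma> u (\<beta> @ \<delta>) @ Vert b # map Edge \<beta>"
    using ctx[OF nf_cancel_left[OF assms(1,3)], of "\<beta> @ \<delta>" "[]" "Vert b # map Edge \<beta>"]
      assms(2,4) by (auto dest: awalkD)
  also have "\<dots> \<approx> nf \<gamma> u \<delta>"
    using assms by (intro nf_cancel_right) auto
  finally show ?thesis .
qed

text \<open>Both sides are multiplied by alpha^* on the left and by beta on the right.\<close>

lemma nf_cancel:
  assumes "nf (\<alpha> @ \<gamma>) u (\<beta> @ \<delta>) \<approx> nf (\<alpha> @ \<gamma>') u' (\<beta> @ \<delta>')"
    and "awalk a \<alpha> m" "awalk b \<beta> n"
    and "awalk m \<gamma> u" "awalk n \<delta> u" "awalk m \<gamma>' u'" "awalk n \<delta>' u'"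
  shows "nf \<gamma> u \<delta> \<approx> nf \<gamma>' u' \<delta>'"
proof -
  have "nf \<gamma> u \<delta> \<approx> (map Star (rev \<alpha>) @ [Vert a]) @ nf (\<alpha> @ \<gamma>) u (\<beta> @ \<delta>) @ Vert b # map Edge \<beta>"
    using nf_cancel_both[OF assms(2,3,4,5)] by (rule eqv_sym)
  also have "\<dots> \<approx> (map Star (rev \<alpha>) @ [Vert a]) @ nf (\<alpha> @ \<gamma>') u' (\<beta> @ \<delta>') @ Vert b # map Edge \<beta>"
    using awalkD[OF assms(2)] awalkD[OF assms(3)] by (intro ctx assms(1)) auto
  also have "\<dots> \<approx> nf \<gamma>' u' \<delta>'"
    by (rule nf_cancel_both) fact+
  finally show ?thesis .
qed

lemma nf_extend:
  assumes "nf \<gamma> u \<delta> \<approx> nf \<gamma>' u' \<delta>'" "set \<alpha> \<subseteq> arcs G" "set \<beta> \<subseteq> arcs G"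
  shows "nf (\<alpha> @ \<gamma>) u (\<beta> @ \<delta>) \<approx> nf (\<alpha> @ \<gamma>') u' (\<beta> @ \<delta>')"
  using ctx[OF assms(1), of "map Edge \<alpha>" "map Star (rev \<beta>)"] assms(2,3) by (simp add: nf_def)

lemma path_absorb_right:
  assumes "awalk a \<alpha> u" "\<alpha> \<noteq> []"
  shows "nf \<alpha> u [] \<approx> map Edge \<alpha>"
proof -
  obtain \<beta> e where \<alpha>: "\<alpha> = \<beta> @ [e]" using assms(2) by (metis rev_exhaust)
  then have "e \<in> arcs G" "u = head G e" "set \<beta> \<subseteq> arcs G"
    using assms(1) by (auto simp: awalk_append_conv awalk_simps)
  then show ?thesis
    using ctx[OF defining(3), of e "map Edge \<beta>" "[]"] by (simp add: \<alpha> nf_def)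
qed

text \<open>The common prefix cancels, and at the first difference there remains e^* f with distinct
  edges, which is zero.\<close>

lemma star_path_parallel:
  assumes "awalk a \<alpha> u" "awalk a \<gamma> w" "\<alpha> \<parallel> \<gamma>"
  shows "vanishes (map Star (rev \<alpha>) @ Vert a # map Edge \<gamma>)"
proof -
  obtain p e \<alpha>' f \<gamma>' where [simp]: "\<alpha> = p @ e # \<alpha>'" "\<gamma> = p @ f # \<gamma>'" and ef: "e \<noteq> f"
    using parallel_decomp[OF assms(3)] by blast
  obtain m where p: "awalk a p m" and m: "m = tail G f"
    and arcs: "e \<in> arcs G" "f \<in> arcs G" "set \<alpha>' \<subseteq> arcs G" "set \<gamma>' \<subseteq> arcs G"
    using assms(1,2) by (auto simp: awalk_append_conv awalk_Cons_iff)
  have "map Star (rev \<alpha>) @ Vert a # map Edge \<gamma> \<approx>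
      map Star (rev \<alpha>') @ Star e # Vert m # Edge f # map Edge \<gamma>'"
    using ctx[OF star_path_cancel[OF p], of "map Star (rev \<alpha>') @ [Star e]" "Edge f # map Edge \<gamma>'"]
      arcs by simp
  also have "\<dots> \<approx> map Star (rev \<alpha>') @ [Star e, Edge f] @ map Edge \<gamma>'"
    using ctx[OF defining(2), of f "map Star (rev \<alpha>') @ [Star e]" "map Edge \<gamma>'"] arcs m by simp
  also have "vanishes \<dots>"
    using arcs ef by (intro vanishes_ctx defining_zero) auto
  finally show ?thesis .
qed

lemma vanishes_vert_nf:
  assumes "awalk a \<alpha> u" "set \<beta> \<subseteq> arcs G" "v \<in> verts G" "v \<noteq> a"
  shows "vanishes (Vert v # nf \<alpha> u \<beta>)"
proof -
  note w = awalkD[OF assms(1)]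
  have "Vert v # nf \<alpha> u \<beta> \<approx> [] @ [Vert v, Vert a] @ nf \<alpha> u \<beta>"
    using ctx[OF nf_absorb_left[THEN eqv_sym], of a \<alpha> u \<beta> "[Vert v]" "[]"] w assms by simp
  also have "vanishes \<dots>"
    using w assms by (intro vanishes_ctx defining_zero) auto
  finally show ?thesis .
qed

lemma vanishes_nf_vert:
  assumes "awalk b \<beta> u" "set \<alpha> \<subseteq> arcs G" "v \<in> verts G" "v \<noteq> b"
  shows "vanishes (nf \<alpha> u \<beta> @ [Vert v])"
proof -
  note w = awalkD[OF assms(1)]
  have "nf \<alpha> u \<beta> @ [Vert v] \<approx> nf \<alpha> u \<beta> @ [Vert b, Vert v] @ []"
    using ctx[OF nf_absorb_right[THEN eqv_sym], of b \<beta> u \<alpha> "[]" "[Vert v]"] w assms by simp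
  also have "vanishes \<dots>"
    using w assms by (intro vanishes_ctx defining_zero) auto
  finally show ?thesis .
qed

section \<open>Existence of normal forms\<close>

definition has_nf :: "('v, 'e) generator list \<Rightarrow> bool" where
  "has_nf w \<longleftrightarrow> (\<exists>a \<alpha> u b \<beta>. awalk a \<alpha> u \<and> awalk b \<beta> u \<and> w \<approx> nf \<alpha> u \<beta>)"

lemma has_nfI: "awalk a \<alpha> u \<Longrightarrow> awalk b \<beta> u \<Longrightarrow> w \<approx> nf \<alpha> u \<beta> \<Longrightarrow> has_nf w"
  unfolding has_nf_def by blast

text \<open>The rewriting step that builds a normal form from right to left: a new letter is
  absorbed, cancels with the first edge of alpha, lengthens a path, or gives zero. When alpha is
  empty, \<open>Star e\<close> lengthens beta at its end, because stars stand in reversed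
  order.\<close>

lemma generator_nf:
  assumes x: "x \<in> generators G" and \<alpha>: "awalk a \<alpha> u" and \<beta>: "awalk b \<beta> u"
  shows "vanishes (x # nf \<alpha> u \<beta>) \<or> has_nf (x # nf \<alpha> u \<beta>)"
proof -
  note w = awalkD[OF \<alpha>] awalkD[OF \<beta>]
  have self: "x # nf \<alpha> u \<beta> \<approx> x # nf \<alpha> u \<beta>"
    using w x by (intro eqv_refl) auto
  show ?thesis
  proof (cases x)
    case (Vert v)
    then show ?thesis
      using nf_absorb_left[OF \<alpha> w(4)] vanishes_vert_nf[OF \<alpha> w(4)] has_nfI[OF \<alpha> \<beta>] x by auto
  next
    case (Edge e)
    then have e: "e \<in> arcs G" using x by simp
    show ?thesis
    proof (cases "head G e = a")
      case True
      then have "has_nf (x # nf \<alpha> u \<beta>)"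
        using e \<alpha> self Edge by (intro has_nfI[of "tail G e" "e # \<alpha>" u b \<beta>] \<beta>) (auto simp: awalk_Cons_iff nf_def)
      then show ?thesis ..
    next
      case False
      have "x # nf \<alpha> u \<beta> \<approx> [Edge e] @ (Vert (head G e) # nf \<alpha> u \<beta>) @ []"
        using ctx[OF defining(3)[THEN eqv_sym], of e "[]" "nf \<alpha> u \<beta>"] e w Edge by simp
      also have "vanishes \<dots>"
        using e w False by (intro vanishes_ctx vanishes_vert_nf[OF \<alpha>]) auto
      finally show ?thesis ..
    qed
  next
    case (Star e)
    then have e: "e \<in> arcs G" using x by simp
    show ?thesis
    proof (cases \<alpha>)
      case Nil
      then have a: "a = u" using \<alpha> by (simp add: awalk_Nil_iff)
      show ?thesis
      proof (cases "tail G e = u")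
        case True
        have "x # nf \<alpha> u \<beta> \<approx> Star e # map Star (rev \<beta>)"
          using ctx[OF defining(5), of e "[]" "map Star (rev \<beta>)"] e w True Nil Star by (simp add: nf_def)
        also have "\<dots> \<approx> nf [] (head G e) (\<beta> @ [e])"
          using ctx[OF defining(4)[THEN eqv_sym], of e "[]" "map Star (rev \<beta>)"] e w
          by (simp add: nf_def)
        finally have "has_nf (x # nf \<alpha> u \<beta>)"
          using e True \<beta> by (intro has_nfI[of "head G e" "[]" "head G e" b "\<beta> @ [e]"])
            (auto simp: awalk_append_conv awalk_simps)
        then show ?thesis ..
      next
        case False
        have "x # nf \<alpha> u \<beta> \<approx> [Star e] @ (Vert (tail G e) # nf \<alpha> u \<beta>) @ []"
          using ctx[OF defining(5)[THEN eqv_sym], of e "[]" "nf \<alpha> u \<beta>"] e w Star by simp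
        also have "vanishes \<dots>"
          using e w False a by (intro vanishes_ctx vanishes_vert_nf[OF \<alpha>]) auto
        finally show ?thesis ..
      qed
    next
      case (Cons f \<alpha>')
      then have f: "f \<in> arcs G" "awalk (head G f) \<alpha>' u" "set \<alpha>' \<subseteq> arcs G"
        using \<alpha> by (auto simp: awalk_Cons_iff)
      show ?thesis
      proof (cases "e = f")
        case True
        have "x # nf \<alpha> u \<beta> \<approx> Vert (head G f) # nf \<alpha>' u \<beta>"
          using ctx[OF defining(6), of f "[]" "nf \<alpha>' u \<beta>"] f w True Cons Star by (simp add: nf_def)
        also have "\<dots> \<approx> nf \<alpha>' u \<beta>"
          using f w by (intro nf_absorb_left)
        finally have "has_nf (x # nf \<alpha> u \<beta>)"
          by (intro has_nfI[OF f(2) \<beta>])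
        then show ?thesis ..
      next
        case False
        then have "vanishes (x # nf \<alpha> u \<beta>)"
          using vanishes_ctx[OF defining_zero(2), of f e "[]" "nf \<alpha>' u \<beta>"] e f w Cons Star
          by (simp add: nf_def)
        then show ?thesis ..
      qed
    qed
  qed
qed

lemma normal_form:
  assumes "w \<noteq> []" "set w \<subseteq> generators G"
  shows "vanishes w \<or> has_nf w"
  using assms
proof (induction w)
  case (Cons x w)
  then have x: "x \<in> generators G" by simp
  show ?case
  proof (cases "w = []")
    case True
    show ?thesis
    proof (cases x)
      case (Vert v)
      then have "has_nf [x]"
        using x by (intro has_nfI[of v "[]" v v "[]"]) (auto simp: awalk_Nil_iff nf_def intro: eqv_refl)
      then show ?thesis using True by simp
    next
      case (Edge e)
      then have "has_nf [x]"
        using x defining(3)[THEN eqv_sym, of e]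
        by (intro has_nfI[of "tail G e" "[e]" "head G e" "head G e" "[]"]) (auto simp: awalk_simps nf_def)
      then show ?thesis using True by simp
    next
      case (Star e)
      then have "has_nf [x]"
        using x defining(4)[THEN eqv_sym, of e]
        by (intro has_nfI[of "head G e" "[]" "head G e" "tail G e" "[e]"]) (auto simp: awalk_simps nf_def)
      then show ?thesis using True by simp
    qed
  next
    case False
    then consider "vanishes w" | a \<alpha> u b \<beta> where "awalk a \<alpha> u" "awalk b \<beta> u" "w \<approx> nf \<alpha> u \<beta>"
      using Cons unfolding has_nf_def by auto
    then show ?thesis
    proof cases
      case 1
      then show ?thesis using vanishes_ctx[of w "[x]" "[]"] x by simp
    next
      case 2
      have *: "x # w \<approx> x # nf \<alpha> u \<beta>" using ctx[OF 2(3), of "[x]" "[]"] x by simp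
      then show ?thesis
        using generator_nf[OF x 2(1,2)] eqv_vanishes[OF *] eqv_trans[OF *]
        unfolding has_nf_def by blast
    qed
  qed
qed simp

end

section \<open>Cycles\<close>

abbreviation list_power :: "nat \<Rightarrow> 'a list \<Rightarrow> 'a list" where
  "list_power k c \<equiv> concat (replicate k c)"

lemma list_power_add: "list_power (m + k) c = list_power m c @ list_power k c"
  by (simp add: replicate_add)

lemma list_power_shift: "p @ list_power m (q @ p) = list_power m (p @ q) @ p"
  by (induction m) auto

lemma map_eq_append_ConsD:
  assumes "map f xs = ys @ b # zs"
  shows "\<exists>x a y. xs = x @ a # y \<and> f a = b \<and> map f x = ys \<and> map f y = zs"
proof -
  obtain us vs where us: "xs = us @ vs" "ys = map f us" and vs: "map f vs = b # zs"
    using assms by (auto simp: map_eq_append_conv)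
  obtain a y where "vs = a # y" "f a = b" "map f y = zs"
    using vs by (auto simp: map_eq_Cons_conv)
  then show ?thesis using us by blast
qed

context wf_digraph
begin

lemma is_cycle_iff:
  "is_cycle G c \<longleftrightarrow> c \<noteq> [] \<and> awalk (path_source G c) c (path_source G c) \<and> distinct (map (tail G) c)"
proof -
  have "path_range G c = path_source G c" if "c \<noteq> []" "awalk (path_source G c) c (path_source G c)"
    using that awlast_of_awalk[of "path_source G c" c] by (auto simp: awalk_verts_conv awalk_conv)
  then show ?thesis unfolding is_cycle_def by metis
qed

lemma awalk_list_power: "awalk u c u \<Longrightarrow> awalk u (list_power k c) u"
  by (induction k) (auto simp: awalk_Nil_iff awalk_append_conv dest: awalkD)

lemma awalk_appendD: "awalk u p v \<Longrightarrow> awalk u (p @ q) w \<Longrightarrow> awalk v q w"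
  by (auto simp: awalk_append_iff)

lemma awalk_source: "awalk u p v \<Longrightarrow> p \<noteq> [] \<Longrightarrow> path_source G p = u"
  by (cases p) (auto simp: awalk_Cons_iff)

text \<open>A shortest nonempty closed walk has no repeated vertex, since a repetition can be cut out.\<close>

lemma cycle_exists:
  assumes "awalk u \<pi> u" "\<pi> \<noteq> []" "tail G ` set \<pi> \<subseteq> W"
  obtains c where "is_cycle G c" "path_source G c = u" "tail G ` set c \<subseteq> W"
proof -
  define P where "P c \<longleftrightarrow> awalk u c u \<and> c \<noteq> [] \<and> tail G ` set c \<subseteq> W" for c
  define c where "c = arg_min length P"
  have c: "P c" and min: "\<And>d. P d \<Longrightarrow> length c \<le> length d"
    using arg_min_nat_lemma[of P \<pi> length] assms unfolding c_def P_def by auto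
  have "distinct (map (tail G) c)"
  proof (rule ccontr)
    assume "\<not> distinct (map (tail G) c)"
    then obtain xs ys zs t where "map (tail G) c = xs @ [t] @ ys @ [t] @ zs"
      using not_distinct_decomp by blast
    then obtain x e c' where "c = x @ e # c'" "tail G e = t" "map (tail G) c' = ys @ t # zs"
      by (auto dest!: map_eq_append_ConsD)
    moreover from this(3) obtain y f z where "c' = y @ f # z" "tail G f = t"
      by (auto dest!: map_eq_append_ConsD)
    ultimately have d: "c = x @ e # y @ f # z" "tail G e = t" "tail G f = t"
      by simp_all
    then have "P (x @ f # z)"
      using c unfolding P_def by (auto simp: awalk_append_conv awalk_Cons_iff)
    from min[OF this] show False using d by simp
  qed
  then show ?thesis
    using that[of c] c awalk_source unfolding P_def is_cycle_iff by auto
qed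

text \<open>At the first difference two distinct edges would leave the same vertex. As the source of
  an edge of \<open>p\<close>, that vertex lies in \<open>W\<close> and has index one.\<close>

lemma prefix_comparable_walks:
  assumes W: "W \<subseteq> index_one_verts G"
    and p: "awalk u p v" "tail G ` set p \<subseteq> W" and q: "awalk u q w"
  shows "\<not> p \<parallel> q"
proof
  assume "p \<parallel> q"
  then obtain x e y f z where d: "p = x @ e # y" "q = x @ f # z" "e \<noteq> f"
    using parallel_decomp by blast
  obtain m where x: "awalk u x m" and e: "e \<in> out_arcs G m" "m \<in> W"
    using p d by (auto simp: awalk_append_conv awalk_Cons_iff)
  obtain m' where "awalk u x m'" and f: "f \<in> out_arcs G m'"
    using q d by (auto simp: awalk_append_conv awalk_Cons_iff)
  then have "m' = m" using x by (metis awalk_ends awalk_empty_ends)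
  moreover have "card (out_arcs G m) = 1" using e(2) W by (auto simp: index_one_verts_def)
  ultimately show False using e(1) f d(3) by (metis card_1_singletonE singletonD)
qed

text \<open>The walk is comparable with c, so copies of c can be split off its front. A nonempty
  proper prefix of c cannot be closed: the edge of c that follows it would start at s(c)
  again.\<close>

lemma closed_walk_is_power:
  assumes W: "W \<subseteq> index_one_verts G" and c: "is_cycle G c" "tail G ` set c \<subseteq> W"
    and \<pi>: "awalk (path_source G c) \<pi> (path_source G c)"
  shows "\<exists>k. \<pi> = list_power k c"
  using \<pi>
proof (induction \<pi> rule: length_induct)
  case (1 \<pi>)
  let ?u = "path_source G c"
  have c': "c \<noteq> []" "awalk ?u c ?u" "distinct (map (tail G) c)"
    using c by (auto simp: is_cycle_iff)
  consider "\<pi> = []" | "prefix c \<pi>" | "strict_prefix \<pi> c" "\<pi> \<noteq> []"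
    using prefix_comparable_walks[OF W c'(2) c(2) 1(2)] by (auto simp: strict_prefix_def)
  then show ?case
  proof cases
    case 1
    then show ?thesis by (intro exI[of _ 0]) simp
  next
    case 2
    then obtain \<sigma> where \<sigma>: "\<pi> = c @ \<sigma>" by (auto simp: prefix_def)
    then have "awalk ?u \<sigma> ?u"
      using 1(2) c' by (metis awalk_append_conv awalk_ends)
    moreover have "length \<sigma> < length \<pi>" using \<sigma> c'(1) by simp
    ultimately obtain k where "\<sigma> = list_power k c" using 1 by blast
    then have "\<pi> = list_power (Suc k) c" using \<sigma> by simp
    then show ?thesis ..
  next
    case 3
    then obtain e \<sigma> where \<sigma>: "c = \<pi> @ e # \<sigma>"
      by (metis append_Nil2 neq_Nil_conv prefix_def strict_prefix_def)
    then obtain w where "awalk ?u \<pi> w" "w = tail G e"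
      using c' by (auto simp: awalk_append_conv awalk_Cons_iff)
    then have "tail G e = ?u"
      using 1(2) 3 by (metis awalk_ends)
    moreover have "?u \<in> tail G ` set \<pi>" using \<sigma> 3 by (cases \<pi>) auto
    ultimately show ?thesis using c'(3) \<sigma> by auto
  qed
qed

end

section \<open>Special congruences are determined by their congruence pairs\<close>

context word_congruence
begin

text \<open>The set W of the mapping T, formed for a congruence on words;
  \<open>cong_verts_eq\<close> below identifies the two.\<close>

definition collapsed :: "'v set" where
  "collapsed = {v \<in> verts G. \<exists>e\<in>out_arcs G v. [Edge e, Star e] \<approx> [Vert v]}"

lemma loop_append:
  assumes "nf p u [] \<approx> [Vert u]" "awalk u p u" "awalk u q u"
  shows "nf (p @ q) u [] \<approx> nf q u []"
proof -
  note w = awalkD[OF assms(2)] awalkD[OF assms(3)]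
  have "nf (p @ q) u [] \<approx> nf p u [] @ map Edge q"
    using ctx[OF path_vert[OF assms(3)], of "map Edge p" "[]"] w
    by (auto simp: nf_def intro: eqv_sym)
  also have "\<dots> \<approx> [Vert u] @ map Edge q"
    using ctx[OF assms(1), of "[]" "map Edge q"] w by simp
  also have "\<dots> \<approx> nf q u []"
    using path_vert[OF assms(3)] by (simp add: nf_def)
  finally show ?thesis .
qed

text \<open>Conjugation by p: the rotated loop q p equals p^* (p q) p, and p^* u p = m.\<close>

lemma loop_rotate:
  assumes "nf (p @ q) u [] \<approx> [Vert u]" and p: "awalk u p m" and q: "awalk m q u"
  shows "nf (q @ p) m [] \<approx> [Vert m]"
proof -
  note w = awalkD[OF p] awalkD[OF q]
  have 1: "awalk u (p @ q) u" using p q by (auto simp: awalk_append_conv)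
  have "nf (q @ p) m [] \<approx> map Edge q @ Vert u # map Edge p"
    using ctx[OF path_vert[OF p, THEN eqv_sym], of "map Edge q" "[]"] w by (simp add: nf_def)
  also have "\<dots> \<approx> (map Star (rev p) @ Vert u # nf (p @ q) u []) @ map Edge p"
    using ctx[OF nf_cancel_left[OF p q, of "[]", THEN eqv_sym], of "[]" "map Edge p"] w
    by (simp add: nf_def)
  also have "\<dots> \<approx> map Star (rev p) @ nf (p @ q) u [] @ map Edge p"
    using ctx[OF nf_absorb_left[OF 1, of "[]"], of "map Star (rev p)" "map Edge p"] w by simp
  also have "\<dots> \<approx> map Star (rev p) @ [Vert u] @ map Edge p"
    using w by (intro ctx assms(1)) auto
  also have "\<dots> \<approx> [Vert m]"
    using star_path_cancel[OF p] by simp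
  finally show ?thesis .
qed

text \<open>A right inverse w of e already forces the collapse: e e^* ~ e e^* e w = e w ~
  s(e).\<close>

lemma step_collapsed:
  assumes e: "e \<in> arcs G" and "[Edge e] @ w \<approx> [Vert (tail G e)]" "set w \<subseteq> generators G"
  shows "tail G e \<in> collapsed"
proof -
  have "[Edge e, Star e] \<approx> [Edge e, Star e, Vert (tail G e)]"
    using ctx[OF defining(5)[OF e, THEN eqv_sym], of "[Edge e]" "[]"] e by simp
  also have "\<dots> \<approx> [Edge e, Star e] @ ([Edge e] @ w) @ []"
    using ctx[OF eqv_sym[OF assms(2)], of "[Edge e, Star e]" "[]"] e by simp
  also have "\<dots> \<approx> [Edge e] @ [Vert (head G e)] @ w"
    using ctx[OF defining(6)[OF e], of "[Edge e]" w] e assms(3) by simp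
  also have "\<dots> \<approx> [Edge e] @ w"
    using ctx[OF defining(3)[OF e], of "[]" w] assms(3) by simp
  also have "\<dots> \<approx> [Vert (tail G e)]" by fact
  finally show ?thesis
    using e by (auto simp: collapsed_def)
qed

text \<open>Rotating the loop brings any of its edges to the front; the rest of the loop is then a
  right inverse of that edge.\<close>

lemma loop_collapsed:
  assumes "nf \<pi> u [] \<approx> [Vert u]" "awalk u \<pi> u"
  shows "tail G ` set \<pi> \<subseteq> collapsed"
proof
  fix v assume "v \<in> tail G ` set \<pi>"
  then obtain p e q where \<pi>: "\<pi> = p @ e # q" and v: "v = tail G e"
    by (auto dest: split_list)
  then have e: "e \<in> arcs G" and p: "awalk u p v" and q: "awalk v (e # q) u"
    using assms(2) by (auto simp: awalk_append_conv awalk_Cons_iff)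
  have "nf ((e # q) @ p) v [] \<approx> [Vert v]"
    using loop_rotate[OF _ p q] assms(1) \<pi> by simp
  then show "v \<in> collapsed"
    using step_collapsed[OF e, of "nf (q @ p) v []"] v awalkD[OF p] awalkD[OF q] by (simp add: nf_def)
qed

text \<open>The product collapses from the inside: beta beta^* becomes r(e), and then only e e^* is
  left.\<close>

lemma collapsed_path:
  assumes "awalk w \<beta> u" "\<And>e. e \<in> set \<beta> \<Longrightarrow> [Edge e, Star e] \<approx> [Vert (tail G e)]"
  shows "nf \<beta> u \<beta> \<approx> [Vert w]"
  using assms
proof (induction \<beta> arbitrary: w)
  case Nil
  then show ?case by (auto simp: awalk_Nil_iff nf_def intro: eqv_refl)
next
  case (Cons e \<beta>)
  then have e: "e \<in> arcs G" "w = tail G e" and \<beta>: "awalk (head G e) \<beta> u"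
    by (auto simp: awalk_Cons_iff)
  have IH: "nf \<beta> u \<beta> \<approx> [Vert (head G e)]"
    using Cons \<beta> by auto
  have "nf (e # \<beta>) u (e # \<beta>) \<approx> [Edge e, Vert (head G e), Star e]"
    using ctx[OF IH, of "[Edge e]" "[Star e]"] e by (simp add: nf_def)
  also have "\<dots> \<approx> [Edge e, Star e]"
    using ctx[OF defining(3)[OF e(1)], of "[]" "[Star e]"] e by simp
  also have "\<dots> \<approx> [Vert w]" using Cons.prems(2) e by simp
  finally show ?case .
qed

end

section \<open>Consequences of keeping the vertices away from zero\<close>

locale special_word_congruence = word_congruence +
  assumes special: "v \<in> verts G \<Longrightarrow> \<not> vanishes [Vert v]"
begin

text \<open>Suppose g g^* ~ v and a second edge e leaves v. Then r(e) = e^* v e ~ e^* g g^* e = 0,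
  against the assumption on vertices.\<close>

lemma collapsed_unique:
  assumes "v \<in> collapsed" "f \<in> out_arcs G v"
  shows "[Edge f, Star f] \<approx> [Vert v]" "e \<in> out_arcs G v \<Longrightarrow> e = f"
proof -
  obtain g where g: "g \<in> out_arcs G v" "[Edge g, Star g] \<approx> [Vert v]" and v: "v \<in> verts G"
    using assms(1) by (auto simp: collapsed_def)
  have eq: "e = g" if "e \<in> out_arcs G v" for e
  proof (rule ccontr)
    assume neq: "e \<noteq> g"
    have e: "e \<in> arcs G" "tail G e = v" "g \<in> arcs G" using that g by auto
    have "[Vert (head G e)] \<approx> [Star e, Edge e]"
      using defining(6)[OF e(1)] by (rule eqv_sym)
    also have "\<dots> \<approx> [Star e] @ [Vert v] @ [Edge e]"
      using ctx[OF defining(2)[OF e(1), THEN eqv_sym], of "[Star e]" "[]"] e by simp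
    also have "\<dots> \<approx> [Star e] @ [Edge g, Star g] @ [Edge e]"
      using e by (intro ctx eqv_sym[OF g(2)]) auto
    also have "vanishes \<dots>"
      using vanishes_ctx[OF defining_zero(2)[of g e], of "[]" "[Star g, Edge e]"] e neq by simp
    finally show False using special e by simp
  qed
  show "[Edge f, Star f] \<approx> [Vert v]" "e \<in> out_arcs G v \<Longrightarrow> e = f"
    using eq assms(2) g by auto
qed

lemma collapsed_index_one: "collapsed \<subseteq> index_one_verts G"
proof
  fix v assume v: "v \<in> collapsed"
  then obtain g where "g \<in> out_arcs G v" "v \<in> verts G" by (auto simp: collapsed_def)
  then have "out_arcs G v = {g}" using collapsed_unique(2)[OF v] by blast
  then show "v \<in> index_one_verts G"
    using \<open>v \<in> verts G\<close> by (simp add: index_one_verts_def)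
qed

text \<open>Multiplying alpha beta^* by alpha^* on the left and by beta on the right gives the
  vertex u, which is not equivalent to zero.\<close>

lemma nf_not_vanishes:
  assumes "awalk a \<alpha> u" "awalk b \<beta> u"
  shows "\<not> vanishes (nf \<alpha> u \<beta>)"
proof
  note w = awalkD[OF assms(1)] awalkD[OF assms(2)]
  assume *: "vanishes (nf \<alpha> u \<beta>)"
  have "[Vert u] \<approx> (map Star (rev \<alpha>) @ [Vert a]) @ nf (\<alpha> @ []) u (\<beta> @ []) @ Vert b # map Edge \<beta>"
    using nf_cancel_both[OF assms, of "[]" u "[]", THEN eqv_sym] w by (simp add: nf_def awalk_Nil_iff)
  also have "vanishes \<dots>"
    using w * by (intro vanishes_ctx) auto
  finally show False using special w by simp
qed

text \<open>Multiplying by the first vertex of one side preserves that side and kills the other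
  unless the first vertices agree; the right end is similar. Multiplying by alpha^* and beta turns
  the left side into u, which is not zero, and the right side into a word containing both alpha^*
  gamma and delta^* beta. Either factor would be zero for parallel paths.\<close>

lemma nf_eqv_ends:
  assumes eq: "nf \<alpha> u \<beta> \<approx> nf \<gamma> w \<delta>"
    and \<alpha>: "awalk a \<alpha> u" and \<beta>: "awalk b \<beta> u" and \<gamma>: "awalk a' \<gamma> w" and \<delta>: "awalk b' \<delta> w"
  shows "a = a'" "b = b'" "\<not> \<alpha> \<parallel> \<gamma>" "\<not> \<beta> \<parallel> \<delta>"
proof -
  note w = awalkD[OF \<alpha>] awalkD[OF \<beta>] awalkD[OF \<gamma>] awalkD[OF \<delta>]
  show a: "a = a'"
  proof (rule ccontr)
    assume neq: "a \<noteq> a'"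
    have "nf \<alpha> u \<beta> \<approx> Vert a # nf \<alpha> u \<beta>"
      using nf_absorb_left[OF \<alpha>] w by (blast intro: eqv_sym)
    also have "\<dots> \<approx> Vert a # nf \<gamma> w \<delta>" using ctx[OF eq, of "[Vert a]" "[]"] w by simp
    also have "vanishes \<dots>" using vanishes_vert_nf[OF \<gamma>] w neq by simp
    finally show False using nf_not_vanishes \<alpha> \<beta> by blast
  qed
  show b: "b = b'"
  proof (rule ccontr)
    assume neq: "b \<noteq> b'"
    have "nf \<alpha> u \<beta> \<approx> nf \<alpha> u \<beta> @ [Vert b]"
      using nf_absorb_right[OF \<beta>] w by (blast intro: eqv_sym)
    also have "\<dots> \<approx> nf \<gamma> w \<delta> @ [Vert b]" using ctx[OF eq, of "[]" "[Vert b]"] w by simp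
    also have "vanishes \<dots>" using vanishes_nf_vert[OF \<delta>] w neq by simp
    finally show False using nf_not_vanishes \<alpha> \<beta> by blast
  qed
  have "[Vert u] \<approx> (map Star (rev \<alpha>) @ [Vert a]) @ nf \<alpha> u \<beta> @ Vert b # map Edge \<beta>"
    using nf_cancel_both[OF \<alpha> \<beta>, of "[]" u "[]", THEN eqv_sym] w by (simp add: nf_def awalk_Nil_iff)
  also have "\<dots> \<approx> (map Star (rev \<alpha>) @ [Vert a]) @ nf \<gamma> w \<delta> @ Vert b # map Edge \<beta>"
    using w by (intro ctx eq) auto
  finally have *: "[Vert u] \<approx> (map Star (rev \<alpha>) @ [Vert a]) @ nf \<gamma> w \<delta> @ Vert b # map Edge \<beta>" .
  have nv: "\<not> vanishes ((map Star (rev \<alpha>) @ [Vert a]) @ nf \<gamma> w \<delta> @ Vert b # map Edge \<beta>)"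
    using eqv_vanishes[OF *] special w by blast
  show "\<not> \<alpha> \<parallel> \<gamma>"
  proof
    assume "\<alpha> \<parallel> \<gamma>"
    then show False
      using nv vanishes_ctx[OF star_path_parallel[OF \<alpha>, of \<gamma> w], of "[]" "Vert w # map Star (rev \<delta>) @ Vert b # map Edge \<beta>"]
        \<gamma> a w by (simp add: nf_def)
  qed
  show "\<not> \<beta> \<parallel> \<delta>"
  proof
    assume "\<beta> \<parallel> \<delta>"
    then show False
      using nv vanishes_ctx[OF star_path_parallel[OF \<delta>, of \<beta> u], of "map Star (rev \<alpha>) @ Vert a # map Edge \<gamma> @ [Vert w]" "[]"]
        \<beta> b w by (simp add: nf_def parallel_commute)
  qed
qed

end

text \<open>The aim is \<open>R1 \<subseteq> R2\<close>. The second congruence is asked only for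
  what the pair of the first provides: the collapses, and for each cycle the relation with the least
  exponent, since this is all that f(c) records.\<close>

locale two_word_congruences =
  A: special_word_congruence G R1 + B: word_congruence G R2
  for G :: "('v, 'e) pre_digraph" and R1 R2 +
  assumes collapse: "e \<in> arcs G \<Longrightarrow> A.eqv [Edge e, Star e] [Vert (tail G e)] \<Longrightarrow>
      B.eqv [Edge e, Star e] [Vert (tail G e)]"
    and cycle_relation: "is_cycle G c \<Longrightarrow> tail G ` set c \<subseteq> A.collapsed \<Longrightarrow> 0 < m \<Longrightarrow>
      A.eqv (nf (list_power m c) (path_source G c) []) [Vert (path_source G c)] \<Longrightarrow>
      (\<And>k. 0 < k \<Longrightarrow> k < m \<Longrightarrow>
        \<not> A.eqv (nf (list_power k c) (path_source G c) []) [Vert (path_source G c)]) \<Longrightarrow>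
      B.eqv (nf (list_power m c) (path_source G c) []) [Vert (path_source G c)]"
begin

lemma collapse_set:
  "tail G ` set \<beta> \<subseteq> A.collapsed \<Longrightarrow> e \<in> set \<beta> \<Longrightarrow> e \<in> arcs G \<Longrightarrow>
    B.eqv [Edge e, Star e] [Vert (tail G e)]"
  using collapse A.collapsed_unique(1)[of "tail G e" e] by auto

text \<open>Division with remainder by repeated subtraction. By \<open>loop_append\<close> the least
  exponent m can be subtracted from k in \<open>R1\<close>; the remaining exponent is treated by
  induction, and \<open>loop_append\<close> in \<open>R2\<close> adds m back.\<close>

lemma cycle_power:
  assumes c: "is_cycle G c" "tail G ` set c \<subseteq> A.collapsed" and u: "u = path_source G c"
    and "A.eqv (nf (list_power k c) u []) [Vert u]"
  shows "B.eqv (nf (list_power k c) u []) [Vert u]"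
  using assms(4)
proof (induction k rule: less_induct)
  case (less k)
  have cw: "A.awalk u c u" using c u by (auto simp: A.is_cycle_iff)
  note pw = A.awalk_list_power[OF cw]
  show ?case
  proof (cases "k = 0")
    case True
    then show ?thesis using A.awalkD[OF cw] by (auto simp: nf_def intro: B.eqv_refl)
  next
    case False
    define P where "P m \<longleftrightarrow> 0 < m \<and> A.eqv (nf (list_power m c) u []) [Vert u]" for m
    define m where "m = (LEAST m. P m)"
    have "P k" using False less.prems by (simp add: P_def)
    then have m: "P m" "m \<le> k" and least: "\<And>j. j < m \<Longrightarrow> \<not> P j"
      unfolding m_def by (auto intro: LeastI Least_le dest: not_less_Least)
    have Bm: "B.eqv (nf (list_power m c) u []) [Vert u]"
      using cycle_relation[OF c, of m] m(1) least u unfolding P_def by auto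
    have k: "list_power k c = list_power m c @ list_power (k - m) c"
      using m(2) by (simp add: list_power_add[symmetric])
    have "A.eqv (nf (list_power (k - m) c) u []) (nf (list_power k c) u [])"
      unfolding k using m(1) pw unfolding P_def by (intro A.eqv_sym[OF A.loop_append]) auto
    then have "A.eqv (nf (list_power (k - m) c) u []) [Vert u]"
      using less.prems by (rule A.eqv_trans)
    then have "B.eqv (nf (list_power (k - m) c) u []) [Vert u]"
      using less.IH[of "k - m"] m False unfolding P_def by simp
    then show ?thesis
      unfolding k using B.loop_append[OF Bm pw pw] B.eqv_trans by blast
  qed
qed

text \<open>A nonempty loop equivalent to its vertex runs through collapsed vertices only, so it is
  a power of a cycle.\<close>

lemma loop:
  assumes "A.eqv (nf \<pi> u []) [Vert u]" "A.awalk u \<pi> u"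
  shows "B.eqv (nf \<pi> u []) [Vert u]"
proof (cases "\<pi> = []")
  case True
  then show ?thesis using A.awalkD[OF assms(2)] by (auto simp: nf_def intro: B.eqv_refl)
next
  case False
  obtain c where c: "is_cycle G c" "path_source G c = u" "tail G ` set c \<subseteq> A.collapsed"
    using A.cycle_exists[OF assms(2) False A.loop_collapsed[OF assms]] by blast
  then obtain k where "\<pi> = list_power k c"
    using A.closed_walk_is_power[OF A.collapsed_index_one, of c \<pi>] assms(2) by blast
  then show ?thesis using cycle_power[OF c(1,3)] c(2) assms(1) by simp
qed

text \<open>Multiplying beta^* ~ gamma by beta gives the loop relation gamma beta ~ u, which passes
  to \<open>R2\<close> by \<open>loop\<close>. There it is multiplied by beta^*, and beta beta^*
  collapses because the vertices of the loop do.\<close>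

lemma star_path:
  assumes \<beta>: "A.awalk w \<beta> u" and \<gamma>: "A.awalk u \<gamma> w" and eq: "A.eqv (nf [] u \<beta>) (nf \<gamma> w [])"
  shows "B.eqv (nf [] u \<beta>) (nf \<gamma> w [])"
proof -
  note w = A.awalkD[OF \<beta>] A.awalkD[OF \<gamma>]
  have cl: "A.awalk u (\<gamma> @ \<beta>) u" using \<beta> \<gamma> by (auto simp: A.awalk_append_conv)
  have "A.eqv (nf (\<gamma> @ \<beta>) u []) (map Edge \<gamma> @ Vert w # map Edge \<beta>)"
    using A.ctx[OF A.path_vert[OF \<beta>, THEN A.eqv_sym], of "map Edge \<gamma>" "[]"] w by (simp add: nf_def)
  also have "A.eqv \<dots> (nf \<gamma> w [] @ Vert w # map Edge \<beta>)"
    using A.ctx[OF A.defining(1)[THEN A.eqv_sym], of w "map Edge \<gamma>" "map Edge \<beta>"] w by (simp add: nf_def)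
  also have "A.eqv \<dots> (nf [] u \<beta> @ Vert w # map Edge \<beta>)"
    using A.ctx[OF A.eqv_sym[OF eq], of "[]" "Vert w # map Edge \<beta>"] w by simp
  also have "A.eqv \<dots> [Vert u]"
    using A.nf_cancel_right[OF \<beta>, of "[]" u "[]"] w by (simp add: nf_def A.awalk_Nil_iff)
  finally have *: "A.eqv (nf (\<gamma> @ \<beta>) u []) [Vert u]" .
  have "tail G ` set \<beta> \<subseteq> A.collapsed"
    using A.loop_collapsed[OF * cl] by auto
  then have D: "B.eqv (nf \<beta> u \<beta>) [Vert w]"
    using w by (intro B.collapsed_path[OF \<beta>] collapse_set) auto
  have "B.eqv (nf [] u \<beta>) (nf (\<gamma> @ \<beta>) u [] @ map Star (rev \<beta>))"
    using B.ctx[OF loop[OF * cl, THEN B.eqv_sym], of "[]" "map Star (rev \<beta>)"] w by (simp add: nf_def)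
  also have "B.eqv \<dots> (nf \<gamma> w [])"
    using B.ctx[OF D, of "map Edge \<gamma>" "[]"] w by (simp add: nf_def)
  finally show ?thesis .
qed

text \<open>If one of the paths is empty, this is a case of \<open>star_path\<close>. Otherwise the
  first edge of gamma has a right inverse, so u is collapsed and both paths begin with the same edge
  e. Cancelling e on both sides gives a shorter relation at r(e); it is carried back by e e^* ~ u in
  \<open>R2\<close>.\<close>

lemma vertex_nf:
  assumes "A.awalk u \<gamma> w" "A.awalk u \<delta> w" "A.eqv [Vert u] (nf \<gamma> w \<delta>)"
  shows "B.eqv [Vert u] (nf \<gamma> w \<delta>)"
  using assms
proof (induction \<gamma> arbitrary: u \<delta>)
  case Nil
  then have "u = w" by (simp add: A.awalk_Nil_iff)
  then show ?case
    using star_path[of u \<delta> u "[]"] Nil by (auto simp: nf_def intro: A.eqv_sym B.eqv_sym)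
next
  case (Cons e \<gamma>)
  show ?case
  proof (cases \<delta>)
    case Nil
    then have "u = w" using Cons.prems by (simp add: A.awalk_Nil_iff)
    then show ?thesis
      using star_path[of w "[]" u "e # \<gamma>"] Cons.prems Nil by (simp add: nf_def)
  next
    case (Cons d \<delta>')
    note prems = Cons.prems and IH = Cons.IH
    have e: "e \<in> arcs G" "tail G e = u" "A.awalk (head G e) \<gamma> w"
      and d: "d \<in> arcs G" "tail G d = u" "A.awalk (head G d) \<delta>' w"
      using prems Cons by (auto simp: A.awalk_Cons_iff)
    note w = A.awalkD[OF e(3)] A.awalkD[OF d(3)]
    have "u \<in> A.collapsed"
      using A.step_collapsed[OF e(1), of "nf \<gamma> w \<delta>"] prems(3) e w d(1) Cons
      by (simp add: nf_def A.eqv_sym)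
    moreover have "e \<in> out_arcs G u" "d \<in> out_arcs G u" using e d by auto
    ultimately have de: "d = e" and "A.eqv [Edge e, Star e] [Vert u]"
      using A.collapsed_unique by blast+
    then have B: "B.eqv [Edge e, Star e] [Vert u]" using collapse e by auto
    have "A.eqv (nf [e] (head G e) [e]) [Vert u]" "B.eqv (nf [e] (head G e) [e]) [Vert u]"
      using B \<open>A.eqv [Edge e, Star e] [Vert u]\<close> e w
      by (intro A.collapsed_path B.collapsed_path; force simp: A.awalk_simps)+
    note AB = this
    have "A.eqv (nf ([e] @ []) (head G e) ([e] @ [])) (nf ([e] @ \<gamma>) w ([e] @ \<delta>'))"
      using A.eqv_trans[OF AB(1) prems(3)] Cons de by simp
    then have "A.eqv (nf [] (head G e) []) (nf \<gamma> w \<delta>')"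
    proof (rule A.nf_cancel)
      show "A.awalk u [e] (head G e)" "A.awalk u [e] (head G e)" "A.awalk (head G e) \<gamma> w"
        "A.awalk (head G e) [] (head G e)" "A.awalk (head G e) [] (head G e)"
        using e w by (simp_all add: A.awalk_simps)
      show "A.awalk (head G e) \<delta>' w" using d(3) de by simp
    qed
    then have "B.eqv [Vert (head G e)] (nf \<gamma> w \<delta>')"
      using IH[OF e(3), of \<delta>'] d(3) unfolding de by (simp add: nf_def)
    then have "B.eqv (nf ([e] @ []) (head G e) ([e] @ [])) (nf ([e] @ \<gamma>) w ([e] @ \<delta>'))"
      using e by (intro B.nf_extend) (auto simp: nf_def)
    then show ?thesis
      using B.eqv_trans[OF B.eqv_sym[OF AB(2)]] Cons de by simp
  qed
qed

text \<open>Both pairs of paths are prefix-comparable. If the same side has the shorter path in both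
  pairs, cancelling leaves a vertex against a normal form; otherwise it leaves a star path against a
  path.\<close>

lemma nf_eqv:
  assumes eq: "A.eqv (nf \<alpha> u \<beta>) (nf \<gamma> w \<delta>)"
    and \<alpha>: "A.awalk a \<alpha> u" and \<beta>: "A.awalk b \<beta> u" and \<gamma>: "A.awalk a' \<gamma> w" and \<delta>: "A.awalk b' \<delta> w"
  shows "B.eqv (nf \<alpha> u \<beta>) (nf \<gamma> w \<delta>)"
proof -
  note ends = A.nf_eqv_ends[OF assms]
  note arcs = A.awalkD[OF \<alpha>] A.awalkD[OF \<beta>] A.awalkD[OF \<gamma>] A.awalkD[OF \<delta>]
  have nil: "A.awalk u [] u" "A.awalk w [] w" using arcs by (auto simp: A.awalk_Nil_iff)
  have "prefix \<alpha> \<gamma> \<or> prefix \<gamma> \<alpha>" "prefix \<beta> \<delta> \<or> prefix \<delta> \<beta>"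
    using ends(3,4) by auto
  then consider
      \<gamma>' \<delta>' where "\<gamma> = \<alpha> @ \<gamma>'" "\<delta> = \<beta> @ \<delta>'"
    | \<gamma>' \<beta>' where "\<gamma> = \<alpha> @ \<gamma>'" "\<beta> = \<delta> @ \<beta>'"
    | \<alpha>' \<delta>' where "\<alpha> = \<gamma> @ \<alpha>'" "\<delta> = \<beta> @ \<delta>'"
    | \<alpha>' \<beta>' where "\<alpha> = \<gamma> @ \<alpha>'" "\<beta> = \<delta> @ \<beta>'"
    by (metis prefixE)
  then show ?thesis
  proof cases
    case 1
    have s: "A.awalk u \<gamma>' w" "A.awalk u \<delta>' w"
      using A.awalk_appendD[OF \<alpha>] A.awalk_appendD[OF \<beta>] \<gamma> \<delta> unfolding 1 ends by simp_all
    have "A.eqv (nf [] u []) (nf \<gamma>' w \<delta>')"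
      using eq unfolding 1 by (intro A.nf_cancel[OF _ \<alpha> \<beta> nil(1) nil(1) s]) simp
    then have "B.eqv (nf [] u []) (nf \<gamma>' w \<delta>')"
      using vertex_nf[OF s] by (simp add: nf_def)
    then show ?thesis using B.nf_extend[of "[]" u "[]" \<gamma>' w \<delta>' \<alpha> \<beta>] 1 arcs by simp
  next
    case 2
    have s: "A.awalk u \<gamma>' w" "A.awalk w \<beta>' u"
      using A.awalk_appendD[OF \<alpha>] A.awalk_appendD[OF \<delta>] \<gamma> \<beta> unfolding 2 ends by simp_all
    have "A.eqv (nf [] u \<beta>') (nf \<gamma>' w [])"
      using eq \<delta> by (intro A.nf_cancel[OF _ \<alpha> _ nil(1) s(2) s(1) nil(2)]) (simp_all add: 2)
    then have "B.eqv (nf [] u \<beta>') (nf \<gamma>' w [])"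
      using star_path s by blast
    then show ?thesis using B.nf_extend[of "[]" u \<beta>' \<gamma>' w "[]" \<alpha> \<delta>] 2 arcs by simp
  next
    case 3
    have s: "A.awalk w \<alpha>' u" "A.awalk u \<delta>' w"
      using A.awalk_appendD[OF \<gamma>] A.awalk_appendD[OF \<beta>] \<alpha> \<delta> unfolding 3 ends by simp_all
    have "A.eqv (nf \<alpha>' u []) (nf [] w \<delta>')"
      using eq \<gamma> by (intro A.nf_cancel[OF _ _ \<beta> s(1) nil(1) nil(2) s(2)]) (simp_all add: 3)
    then have "B.eqv (nf [] w \<delta>') (nf \<alpha>' u [])"
      using star_path s A.eqv_sym by blast
    then show ?thesis using B.nf_extend[of "[]" w \<delta>' \<alpha>' u "[]" \<gamma> \<beta>] 3 arcs by (simp add: B.eqv_sym)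
  next
    case 4
    have s: "A.awalk w \<alpha>' u" "A.awalk w \<beta>' u"
      using A.awalk_appendD[OF \<gamma>] A.awalk_appendD[OF \<delta>] \<alpha> \<beta> unfolding 4 ends by simp_all
    have "A.eqv (nf \<alpha>' u \<beta>') (nf [] w [])"
      using eq unfolding 4 by (intro A.nf_cancel[OF _ \<gamma> \<delta> s nil(2) nil(2)]) simp
    then have "B.eqv (nf [] w []) (nf \<alpha>' u \<beta>')"
      using vertex_nf[OF s] by (simp add: nf_def A.eqv_sym)
    then show ?thesis using B.nf_extend[of "[]" w "[]" \<alpha>' u \<beta>' \<gamma> \<delta>] 4 arcs by (simp add: B.eqv_sym)
  qed
qed

lemma congruence_subset: "R1 \<subseteq> R2"
proof
  interpret I: word_congruence G "inv_rel G" by (rule A.word_congruence_inv_rel)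
  have IA: "A.eqv x y" "B.eqv x y" if "I.eqv x y" for x y
    using that A.inv_rel_subset B.inv_rel_subset by (auto simp: I.eqv_def A.eqv_def B.eqv_def)
  \<comment> \<open>A word with a normal form does not vanish in the special congruence
    \<open>R1\<close>. Hence a vanishing word is already zero in Inv(G), and so it is zero in
    \<open>R2\<close>.\<close>
  have zero: "B.vanishes w" if "A.vanishes w" "w \<noteq> []" "set w \<subseteq> generators G" for w
  proof -
    have "\<not> I.has_nf w"
      using that(1) A.nf_not_vanishes IA(1) A.eqv_sym A.eqv_vanishes unfolding I.has_nf_def by meson
    then have "I.vanishes w" using I.normal_form that by blast
    then show ?thesis using B.inv_rel_subset by (auto simp: I.vanishes_def B.vanishes_def)
  qed
  have R1: "R1 \<subseteq> words0 G \<times> words0 G" "sym R1" using A.equiv by (auto elim: equivE)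
  have R2: "sym R2" "(None, None) \<in> R2" using B.equiv by (auto elim!: equivE simp: refl_on_def)
  fix z assume "z \<in> R1"
  then obtain x y where z: "z = (x, y)" "(x, y) \<in> R1" "x \<in> words0 G" "y \<in> words0 G"
    using R1(1) by (cases z) auto
  have "(x, y) \<in> R2"
  proof (cases x)
    case None
    then show ?thesis
      using z R1(2) R2 zero by (cases y) (auto simp: A.vanishes_def B.vanishes_def dest: symD)
  next
    case x: (Some v)
    show ?thesis
    proof (cases y)
      case None
      then show ?thesis
        using z x zero by (auto simp: A.vanishes_def B.vanishes_def)
    next
      case y: (Some w)
      have vw: "A.eqv v w" and v: "v \<noteq> []" "set v \<subseteq> generators G" and w: "w \<noteq> []" "set w \<subseteq> generators G"
        using z x y by (auto simp: A.eqv_def)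
      have Bvw: "B.eqv v w"
      proof (cases "A.vanishes w")
        case True
        then have "A.vanishes v" using vw A.eqv_vanishes by blast
        then have "B.vanishes v" "B.vanishes w" using True zero v w by blast+
        then show ?thesis
          using B.equiv unfolding B.vanishes_def B.eqv_def by (meson equivE symD transD)
      next
        case False
        then have "\<not> A.vanishes v" using A.eqv_vanishes[OF A.eqv_sym[OF vw]] by blast
        then have "\<not> I.vanishes v" "\<not> I.vanishes w"
          using False A.inv_rel_subset by (auto simp: I.vanishes_def A.vanishes_def)
        \<comment> \<open>The normal forms are taken modulo \<open>inv_rel G\<close>, which lies in
          both congruences, so the same ones may be used for \<open>R1\<close> and for
          \<open>R2\<close>.\<close>
        then obtain a \<alpha> u b \<beta> a' \<gamma> t b' \<delta> where
          nf: "A.awalk a \<alpha> u" "A.awalk b \<beta> u" "A.awalk a' \<gamma> t" "A.awalk b' \<delta> t"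
          and eq: "I.eqv v (nf \<alpha> u \<beta>)" "I.eqv w (nf \<gamma> t \<delta>)"
          using I.normal_form v w unfolding I.has_nf_def by metis
        have "A.eqv (nf \<alpha> u \<beta>) (nf \<gamma> t \<delta>)"
          using IA(1)[OF eq(1)] IA(1)[OF eq(2)] vw by (meson A.eqv_sym A.eqv_trans)
        then have "B.eqv (nf \<alpha> u \<beta>) (nf \<gamma> t \<delta>)" using nf_eqv nf by blast
        then show ?thesis
          using IA(2)[OF eq(1)] IA(2)[OF eq(2)] by (meson B.eqv_sym B.eqv_trans)
      qed
      then show ?thesis using x y by (simp add: B.eqv_def)
    qed
  qed
  then show "z \<in> R2" using z by simp
qed

end

section \<open>Auxiliary facts on list powers, divisibility and relations\<close>

lemma nth_list_power: "i < m * length c \<Longrightarrow> list_power m c ! i = c ! (i mod length c)"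
proof (induction m arbitrary: i)
  case (Suc m)
  show ?case
  proof (cases "i < length c")
    case False
    then have "list_power m c ! (i - length c) = c ! ((i - length c) mod length c)"
      using Suc.prems by (intro Suc.IH) auto
    then show ?thesis using False by (simp add: nth_append le_mod_geq)
  qed (simp add: nth_append)
qed simp

lemma length_list_power: "length (list_power m c) = m * length c"
  by (induction m) auto

text \<open>Composing two actions asks for an intermediate integer k. The choice k = a always works,
  so the shifts a and b simply add up.\<close>

lemma ex_dvd_diff_iff:
  fixes M a b h :: int
  shows "(\<exists>k. M dvd k - a \<and> M dvd h - (k + b)) \<longleftrightarrow> M dvd h - (a + b)"
proof
  assume "\<exists>k. M dvd k - a \<and> M dvd h - (k + b)"
  then obtain k where "M dvd k - a" "M dvd h - (k + b)" by blast
  from dvd_add[OF this] show "M dvd h - (a + b)" by (simp add: algebra_simps)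
next
  assume "M dvd h - (a + b)"
  then show "\<exists>k. M dvd k - a \<and> M dvd h - (k + b)" by (intro exI[of _ a]) simp
qed

lemma subrel_pairsI:
  "(\<And>a b c d. ((a, b), (c, d)) \<in> r \<Longrightarrow> ((a, b), (c, d)) \<in> s) \<Longrightarrow> r \<subseteq> s"
  by auto

section \<open>A representation separating congruence pairs\<close>

text \<open>A ray is an infinite walk in the graph obtained from \<open>G\<close> by adding a loop \<open>Vert u\<close> at
  each vertex \<open>u\<close> outside \<open>W\<close>; from a vertex of \<open>W\<close> there is only one way to continue.\<close>

locale congruence_pair = wf_digraph G for G :: "('v, 'e) pre_digraph" +
  fixes W :: "'v set" and f :: "'e list \<Rightarrow> enat"
  assumes pair: "(W, f) \<in> congruence_pairs G"
begin

fun gsource :: "('v, 'e) generator \<Rightarrow> 'v" where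
  "gsource (Vert v) = v"
| "gsource (Edge e) = tail G e"
| "gsource (Star e) = head G e"

fun grange :: "('v, 'e) generator \<Rightarrow> 'v" where
  "grange (Vert v) = v"
| "grange (Edge e) = head G e"
| "grange (Star e) = tail G e"

definition rays :: "(nat \<Rightarrow> ('v, 'e) generator) set" where
  "rays = {\<xi>. \<forall>i. \<xi> i \<in> Edge ` arcs G \<union> Vert ` (verts G - W) \<and> gsource (\<xi> (Suc i)) = grange (\<xi> i)}"

definition periodic_from :: "nat \<Rightarrow> 'e list \<Rightarrow> (nat \<Rightarrow> ('v, 'e) generator) \<Rightarrow> bool" where
  "periodic_from k c \<xi> \<longleftrightarrow> (\<forall>i. \<xi> (k + i) = Edge (c ! (i mod length c)))"

text \<open>The representation acts on pairs of a ray and an integer counting traversed edges modulo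
  the following number, which is \<open>0\<close> unless the ray ends in a cycle of finite order.\<close>

definition modulus :: "(nat \<Rightarrow> ('v, 'e) generator) \<Rightarrow> int" where
  "modulus \<xi> = int (Gcd {m * length c | m c. c \<in> cycles_in G W \<and> f c = enat m \<and> (\<exists>k. periodic_from k c \<xi>)})"

text \<open>With composition from left to right, alpha beta^* removes alpha from the front of a ray
  and puts beta there. The modulus depends on the ray, so integers are not reduced; an integer is
  related to a whole residue class instead, which makes the actions relations and not partial
  maps.\<close>

fun gen_act ::
    "('v, 'e) generator \<Rightarrow>
     (((nat \<Rightarrow> ('v, 'e) generator) \<times> int) \<times> (nat \<Rightarrow> ('v, 'e) generator) \<times> int) set" where
  "gen_act (Vert v) = {((\<xi>, g), (\<eta>, h)). \<xi> \<in> rays \<and> gsource (\<xi> 0) = v \<and> \<eta> = \<xi> \<and> modulus \<xi> dvd h - g}"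
| "gen_act (Edge e) = {((\<xi>, g), (\<eta>, h)). \<xi> \<in> rays \<and> \<xi> 0 = Edge e \<and> \<eta> = \<xi> \<circ> Suc \<and> modulus \<xi> dvd h - (g + 1)}"
| "gen_act (Star e) = {((\<eta>, h), (\<xi>, g)). \<xi> \<in> rays \<and> \<xi> 0 = Edge e \<and> \<eta> = \<xi> \<circ> Suc \<and> modulus \<xi> dvd h - (g + 1)}"

definition word_act :: "('v, 'e) generator list \<Rightarrow>
     (((nat \<Rightarrow> ('v, 'e) generator) \<times> int) \<times> (nat \<Rightarrow> ('v, 'e) generator) \<times> int) set" where
  "word_act w = foldr (\<lambda>x r. gen_act x O r) w Id"

definition word0_act :: "('v, 'e) word0 \<Rightarrow>
     (((nat \<Rightarrow> ('v, 'e) generator) \<times> int) \<times> (nat \<Rightarrow> ('v, 'e) generator) \<times> int) set" where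
  "word0_act x = (case x of None \<Rightarrow> {} | Some w \<Rightarrow> word_act w)"

definition kernel :: "(('v, 'e) word0 \<times> ('v, 'e) word0) set" where
  "kernel = {(x, y) \<in> words0 G \<times> words0 G. word0_act x = word0_act y}"

lemma W: "W \<subseteq> index_one_verts G"
  using pair by (simp add: congruence_pairs_def)

lemma f_rotate: "c \<in> cycles_in G W \<Longrightarrow> f (rotate k c) = f c"
  and f_nonzero: "c \<in> cycles_in G W \<Longrightarrow> f c \<noteq> 0"
  and f_extensional: "f \<in> extensional (cycles_in G W)"
  using pair by (auto simp: congruence_pairs_def cycle_functions_def PiE_def)

lemma W_out_arc:
  assumes "v \<in> W"
  shows "out_arcs G v = {the_out_arc G v}"
proof -
  have "card (out_arcs G v) = 1" using assms W by (auto simp: index_one_verts_def)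
  then obtain e where "out_arcs G v = {e}" by (rule card_1_singletonE)
  then show ?thesis by (simp add: the_out_arc_def)
qed

lemma the_out_arc_W: "v \<in> W \<Longrightarrow> the_out_arc G v \<in> arcs G" "v \<in> W \<Longrightarrow> tail G (the_out_arc G v) = v"
  using W_out_arc[of v] by (metis in_out_arcs_conv singletonI)+

lemma cyclesD:
  assumes "c \<in> cycles_in G W"
  shows "is_cycle G c" "c \<noteq> []" "distinct c" "tail G ` set c \<subseteq> W"
    "awalk (path_source G c) c (path_source G c)"
  using assms by (simp_all add: cycles_in_def is_cycle_iff distinct_map)

lemma cycle_step:
  assumes c: "c \<in> cycles_in G W"
  shows "head G (c ! (i mod length c)) = tail G (c ! (Suc i mod length c))"
proof -
  have step: "head G (p ! j) = (if Suc j < length p then tail G (p ! Suc j) else w)"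
    if "awalk u p w" "j < length p" for u p w j
    using that
  proof (induction p arbitrary: u j)
    case (Cons e p)
    then show ?case
      by (cases j; cases p) (auto simp: awalk_simps)
  qed simp
  let ?n = "length c"
  have n: "?n > 0" "i mod ?n < ?n" using cyclesD[OF c] by auto
  have "Suc i mod ?n = (if Suc (i mod ?n) < ?n then Suc (i mod ?n) else 0)"
    by (metis Suc_lessI less_irrefl mod_Suc n(2))
  then show ?thesis
    using step[OF cyclesD(5)[OF c] n(2)] cyclesD(2)[OF c] by (simp add: hd_conv_nth)
qed

lemma raysD:
  assumes "\<xi> \<in> rays"
  shows "gsource (\<xi> (Suc i)) = grange (\<xi> i)"
    and "\<xi> i \<in> Edge ` arcs G \<union> Vert ` (verts G - W)"
    and "\<xi> \<circ> Suc \<in> rays"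
    and "gsource (\<xi> i) \<in> W \<Longrightarrow> \<xi> i = Edge (the_out_arc G (gsource (\<xi> i)))"
proof -
  show "gsource (\<xi> (Suc i)) = grange (\<xi> i)"
    and *: "\<xi> i \<in> Edge ` arcs G \<union> Vert ` (verts G - W)"
    using assms unfolding rays_def by blast+
  show "\<xi> \<circ> Suc \<in> rays"
    using assms by (simp add: rays_def)
  show "\<xi> i = Edge (the_out_arc G (gsource (\<xi> i)))" if w: "gsource (\<xi> i) \<in> W"
  proof -
    obtain e where e: "e \<in> arcs G" "\<xi> i = Edge e" using * w by auto
    then have "e \<in> out_arcs G (gsource (\<xi> i))" by auto
    then have "the_out_arc G (gsource (\<xi> i)) = e" using W_out_arc[OF w] by auto
    then show ?thesis unfolding e(2) by simp
  qed
qed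

text \<open>The ray follows the unique edge at vertices of \<open>W\<close> and stays on the added
  loop once it meets a vertex outside \<open>W\<close>. In particular a ray exists at sinks. The
  last property is what separates e e^* from v in \<open>kernel_collapse_iff\<close>.\<close>

lemma ray_exists:
  assumes v: "v \<in> verts G"
  obtains \<xi> where "\<xi> \<in> rays" "gsource (\<xi> 0) = v" "v \<notin> W \<Longrightarrow> \<xi> 0 = Vert v"
proof -
  define nxt where "nxt u = (if u \<in> W then Edge (the_out_arc G u) else Vert u)" for u
  define vs where "vs i = ((grange \<circ> nxt) ^^ i) v" for i
  have src: "gsource (nxt u) = u" and nxt: "u \<in> verts G \<Longrightarrow> nxt u \<in> Edge ` arcs G \<union> Vert ` (verts G - W)"
    for u using the_out_arc_W[of u] by (auto simp: nxt_def)
  have vs: "vs i \<in> verts G" for i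
  proof (induction i)
    case (Suc i)
    have "nxt (vs i) \<in> Edge ` arcs G \<union> Vert ` (verts G - W)" using nxt Suc by blast
    then have "grange (nxt (vs i)) \<in> verts G" by auto
    then show ?case by (simp add: vs_def)
  qed (simp add: vs_def v)
  have "(\<lambda>i. nxt (vs i)) \<in> rays"
    using nxt[OF vs] src by (auto simp: rays_def vs_def)
  then show ?thesis
    using that[of "\<lambda>i. nxt (vs i)"] src by (simp add: vs_def nxt_def)
qed

lemma modulus_shift: "modulus (\<xi> \<circ> Suc) = modulus \<xi>"
proof -
  have "(\<exists>k. periodic_from k c (\<xi> \<circ> Suc)) \<longleftrightarrow> (\<exists>k. periodic_from k c \<xi>)" if "c \<in> cycles_in G W" for c
  proof
    assume "\<exists>k. periodic_from k c (\<xi> \<circ> Suc)"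
    then obtain k where "periodic_from k c (\<xi> \<circ> Suc)" ..
    then have "periodic_from (Suc k) c \<xi>" by (simp add: periodic_from_def)
    then show "\<exists>k. periodic_from k c \<xi>" ..
  next
    assume "\<exists>k. periodic_from k c \<xi>"
    then obtain k where k: "\<And>i. \<xi> (k + i) = Edge (c ! (i mod length c))"
      by (auto simp: periodic_from_def)
    have n: "length c > 0" using cyclesD(2)[OF that] by simp
    \<comment> \<open>Dropping the first letter would move the starting position to k - 1, which is
      missing for k = 0. Starting one full period later avoids this.\<close>
    have "(\<xi> \<circ> Suc) (k + (length c - 1) + i) = Edge (c ! (i mod length c))" for i
    proof -
      have eq: "Suc (k + (length c - 1) + i) = k + (length c + i)" using n by simp
      show ?thesis unfolding comp_apply eq using k[of "length c + i"] by simp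
    qed
    then show "\<exists>k. periodic_from k c (\<xi> \<circ> Suc)" unfolding periodic_from_def by blast
  qed
  then have "{m * length c | m c. c \<in> cycles_in G W \<and> f c = enat m \<and> (\<exists>k. periodic_from k c (\<xi> \<circ> Suc))} =
      {m * length c | m c. c \<in> cycles_in G W \<and> f c = enat m \<and> (\<exists>k. periodic_from k c \<xi>)}"
    by blast
  then show ?thesis unfolding modulus_def by (simp only:)
qed

section \<open>The action satisfies the defining relations\<close>

lemma word_act_simps [simp]:
  "word_act [] = Id" "word_act (x # w) = gen_act x O word_act w"
  by (simp_all add: word_act_def)

lemma word_act_append: "word_act (u @ w) = word_act u O word_act w"
  by (induction u) (auto simp: O_assoc)

lemma word0_act_mult: "word0_act (word0_mult x y) = word0_act x O word0_act y"
  by (cases x; cases y) (auto simp: word0_act_def word_act_append)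

lemma gen_act_Star: "gen_act (Star e) = (gen_act (Edge e))\<inverse>"
  by auto

lemma gen_act_Vert_converse: "(gen_act (Vert v))\<inverse> = gen_act (Vert v)"
  by (auto simp: dvd_diff_commute)

lemma gen_act_Vert_Vert: "gen_act (Vert u) O gen_act (Vert v) = (if u = v then gen_act (Vert u) else {})"
proof -
  \<comment> \<open>The summand 0 in the last condition brings the composition into the shape of
    \<open>ex_dvd_diff_iff\<close>.\<close>
  have "gen_act (Vert u) O gen_act (Vert v) = {((\<xi>, g), (\<eta>, h)).
      \<xi> \<in> rays \<and> gsource (\<xi> 0) = u \<and> u = v \<and> \<eta> = \<xi> \<and>
      (\<exists>k. modulus \<xi> dvd k - g \<and> modulus \<xi> dvd h - (k + 0))}"
    unfolding relcomp_unfold gen_act.simps by auto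
  then show ?thesis unfolding ex_dvd_diff_iff by simp
qed

lemma gen_act_Vert_Edge: "gen_act (Vert (tail G e)) O gen_act (Edge e) = gen_act (Edge e)"
proof -
  have "gen_act (Vert (tail G e)) O gen_act (Edge e) = {((\<xi>, g), (\<eta>, h)).
      \<xi> \<in> rays \<and> \<xi> 0 = Edge e \<and> \<eta> = \<xi> \<circ> Suc \<and>
      (\<exists>k. modulus \<xi> dvd k - g \<and> modulus \<xi> dvd h - (k + 1))}"
    unfolding relcomp_unfold gen_act.simps by auto
  then show ?thesis unfolding ex_dvd_diff_iff by simp
qed

lemma gen_act_Edge_Vert: "gen_act (Edge e) O gen_act (Vert (head G e)) = gen_act (Edge e)"
proof -
  have "gsource ((\<xi> \<circ> Suc) 0) = head G e" if "\<xi> \<in> rays" "\<xi> 0 = Edge e" for \<xi>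
    using raysD(1)[OF that(1), of 0] that(2) by simp
  then have "gen_act (Edge e) O gen_act (Vert (head G e)) = {((\<xi>, g), (\<eta>, h)).
      \<xi> \<in> rays \<and> \<xi> 0 = Edge e \<and> \<eta> = \<xi> \<circ> Suc \<and>
      (\<exists>k. modulus \<xi> dvd k - (g + 1) \<and> modulus \<xi> dvd h - (k + 0))}"
    unfolding relcomp_unfold gen_act.simps using raysD(3) by (auto simp: modulus_shift)
  then show ?thesis unfolding ex_dvd_diff_iff by simp
qed

lemma gen_act_Star_Edge:
  assumes "e \<in> arcs G"
  shows "gen_act (Star d) O gen_act (Edge e) = (if d = e then gen_act (Vert (head G e)) else {})"
proof (cases "d = e")
  case True
  have "gen_act (Star e) O gen_act (Edge e) \<subseteq> gen_act (Vert (head G e))"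
  proof (rule subrel_pairsI)
    fix \<eta> h \<eta>' h' assume "((\<eta>, h), (\<eta>', h')) \<in> gen_act (Star e) O gen_act (Edge e)"
    then obtain \<xi> g where \<xi>: "\<xi> \<in> rays" "\<xi> 0 = Edge e" "\<eta> = \<xi> \<circ> Suc" "\<eta>' = \<xi> \<circ> Suc"
      and d: "modulus \<xi> dvd h - (g + 1)" "modulus \<xi> dvd h' - (g + 1)"
      by auto
    have "modulus \<xi> dvd h' - h" using dvd_diff[OF d(2,1)] by simp
    then show "((\<eta>, h), (\<eta>', h')) \<in> gen_act (Vert (head G e))"
      using \<xi> raysD(1)[OF \<xi>(1), of 0] raysD(3)[OF \<xi>(1)] by (auto simp: modulus_shift)
  qed
  moreover have "gen_act (Vert (head G e)) \<subseteq> gen_act (Star e) O gen_act (Edge e)"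
  proof (rule subrel_pairsI)
    fix \<eta> h \<eta>' h' assume "((\<eta>, h), (\<eta>', h')) \<in> gen_act (Vert (head G e))"
    then have \<eta>: "\<eta> \<in> rays" "gsource (\<eta> 0) = head G e" "\<eta>' = \<eta>" "modulus \<eta> dvd h' - h" by auto
    \<comment> \<open>Every ray from r(e) can be prefixed by e, so e^* e acts on all rays at r(e).
      Passing along e adds 1, hence the integer h - 1 is attached to the prefixed ray.\<close>
    define \<xi> where "\<xi> = case_nat (Edge e) \<eta>"
    have shift: "\<xi> \<circ> Suc = \<eta>" by (auto simp: \<xi>_def)
    have "\<xi> i \<in> Edge ` arcs G \<union> Vert ` (verts G - W) \<and> gsource (\<xi> (Suc i)) = grange (\<xi> i)" for i
      using \<eta>(2) assms raysD(1,2)[OF \<eta>(1)] by (cases i) (simp_all add: \<xi>_def)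
    then have "\<xi> \<in> rays" by (simp add: rays_def)
    moreover have "\<xi> 0 = Edge e" by (simp add: \<xi>_def)
    moreover have "modulus \<xi> = modulus \<eta>" using modulus_shift[of \<xi>] shift by simp
    ultimately have "((\<eta>, h), (\<xi>, h - 1)) \<in> gen_act (Star e)" "((\<xi>, h - 1), (\<eta>', h')) \<in> gen_act (Edge e)"
      using shift \<eta> by auto
    then show "((\<eta>, h), (\<eta>', h')) \<in> gen_act (Star e) O gen_act (Edge e)" by blast
  qed
  ultimately show ?thesis unfolding \<open>d = e\<close> by (simp only: if_True simp_thms order_antisym)
qed auto

text \<open>\<open>Star e\<close> acts as the converse of \<open>Edge e\<close> and vertices act
  symmetrically, so the relations for stars are the converses of those for edges.\<close>

lemma gen_act_Vert_Star: "gen_act (Vert (head G e)) O gen_act (Star e) = gen_act (Star e)"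
  using arg_cong[OF gen_act_Edge_Vert, of converse e]
  by (simp only: converse_relcomp gen_act_Star gen_act_Vert_converse)

lemma gen_act_Star_Vert: "gen_act (Star e) O gen_act (Vert (tail G e)) = gen_act (Star e)"
  using arg_cong[OF gen_act_Vert_Edge, of converse e]
  by (simp only: converse_relcomp gen_act_Star gen_act_Vert_converse)

text \<open>\<open>word0_act\<close> is a homomorphism into binary relations under composition, and
  zero acts as the empty relation, which composition preserves.\<close>

lemma word_congruence_kernel: "word_congruence G kernel"
proof
  show "semigroup_congruence (words0 G) word0_mult kernel"
    by (intro semigroup_congruenceI equivI)
      (auto simp: kernel_def refl_on_def sym_def trans_def word0_act_mult word0_mult_closed)
  show "defining_relations G \<subseteq> kernel"
    by (auto simp del: gen_act.simps simp: defining_relations_def kernel_def word0_act_def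
        gen_act_Vert_Vert gen_act_Vert_Edge gen_act_Edge_Vert gen_act_Star_Edge gen_act_Vert_Star
        gen_act_Star_Vert)
qed

section \<open>Reading the congruence pair off the kernel\<close>

lemma word_act_nf:
  "word_act (nf \<pi> u []) = {((\<xi>, g), (\<eta>, h)). \<xi> \<in> rays \<and> (\<forall>i<length \<pi>. \<xi> i = Edge (\<pi> ! i)) \<and>
     gsource (\<xi> (length \<pi>)) = u \<and> \<eta> = (\<lambda>i. \<xi> (length \<pi> + i)) \<and>
     modulus \<xi> dvd h - (g + int (length \<pi>))}"
proof (induction \<pi>)
  case Nil
  then show ?case by (auto simp: nf_def)
next
  case (Cons e \<pi>)
  have all: "(\<forall>i<length (e # \<pi>). \<xi> i = Edge ((e # \<pi>) ! i)) \<longleftrightarrow>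
      \<xi> 0 = Edge e \<and> (\<forall>i<length \<pi>. (\<xi> \<circ> Suc) i = Edge (\<pi> ! i))" for \<xi>
    by (auto simp: less_Suc_eq_0_disj)
  have "word_act (nf (e # \<pi>) u []) = gen_act (Edge e) O word_act (nf \<pi> u [])"
    by (simp add: nf_def)
  also have "\<dots> = {((\<xi>, g), (\<eta>, h)). \<xi> \<in> rays \<and> \<xi> 0 = Edge e \<and> (\<forall>i<length \<pi>. (\<xi> \<circ> Suc) i = Edge (\<pi> ! i)) \<and>
     gsource (\<xi> (Suc (length \<pi>))) = u \<and> \<eta> = (\<lambda>i. \<xi> (Suc (length \<pi> + i))) \<and>
     (\<exists>k. modulus \<xi> dvd k - (g + 1) \<and> modulus \<xi> dvd h - (k + int (length \<pi>)))}"
    unfolding Cons.IH by (auto simp: relcomp_unfold modulus_shift raysD(3))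
  finally show ?case
    unfolding all ex_dvd_diff_iff by (simp add: algebra_simps)
qed

lemma kernel_vertex: "v \<in> verts G \<Longrightarrow> (Some [Vert v], None) \<notin> kernel"
proof
  assume v: "v \<in> verts G" and "(Some [Vert v], None) \<in> kernel"
  then have "gen_act (Vert v) = {}" by (simp add: kernel_def word0_act_def)
  moreover obtain \<xi> where "\<xi> \<in> rays" "gsource (\<xi> 0) = v" using ray_exists[OF v] by blast
  then have "((\<xi>, 0), (\<xi>, 0)) \<in> gen_act (Vert v)" by simp
  ultimately show False by blast
qed

text \<open>Outside \<open>W\<close>, a ray beginning with the loop at v is fixed by v but is not in
  the domain of e e^*. Inside \<open>W\<close>, every ray from v begins with e, so removing e and
  putting it back is defined wherever v acts.\<close>

lemma kernel_collapse_iff: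
  assumes "v \<in> verts G" "e \<in> out_arcs G v"
  shows "(Some [Edge e, Star e], Some [Vert v]) \<in> kernel \<longleftrightarrow> v \<in> W"
proof
  assume "(Some [Edge e, Star e], Some [Vert v]) \<in> kernel"
  then have eq: "gen_act (Edge e) O gen_act (Star e) = gen_act (Vert v)"
    by (simp del: gen_act.simps add: kernel_def word0_act_def)
  show "v \<in> W"
  proof (rule ccontr)
    assume "v \<notin> W"
    then obtain \<xi> where \<xi>: "\<xi> \<in> rays" "gsource (\<xi> 0) = v" "\<xi> 0 = Vert v"
      using ray_exists[OF assms(1)] by metis
    then have "((\<xi>, 0), (\<xi>, 0)) \<in> gen_act (Vert v)" by simp
    then have "((\<xi>, 0), (\<xi>, 0)) \<in> gen_act (Edge e) O gen_act (Star e)" using eq by simp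
    then show False using \<xi>(3) by auto
  qed
next
  assume v: "v \<in> W"
  have e: "e \<in> arcs G" "tail G e = v" "e = the_out_arc G v"
    using assms(2) W_out_arc[OF v] the_out_arc_W[OF v] by simp_all
  have first: "\<xi> 0 = Edge e \<longleftrightarrow> gsource (\<xi> 0) = v" if "\<xi> \<in> rays" for \<xi>
    using raysD(4)[OF that, of 0] e v by auto
  have inj: "\<xi> = \<eta>" if "\<xi> 0 = \<eta> 0" "\<xi> \<circ> Suc = \<eta> \<circ> Suc" for \<xi> \<eta> :: "nat \<Rightarrow> ('v, 'e) generator"
  proof
    fix i show "\<xi> i = \<eta> i" using that(1) fun_cong[OF that(2)] by (cases i) auto
  qed
  have "gen_act (Edge e) O gen_act (Star e) = gen_act (Vert v)"
  proof (intro equalityI; rule subrel_pairsI)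
    fix \<xi> g \<eta> h assume "((\<xi>, g), (\<eta>, h)) \<in> gen_act (Edge e) O gen_act (Star e)"
    then obtain k where *: "\<xi> \<in> rays" "\<xi> 0 = Edge e" "\<eta> 0 = Edge e" "\<xi> \<circ> Suc = \<eta> \<circ> Suc"
      "modulus \<xi> dvd k - (g + 1)" "modulus \<eta> dvd k - (h + 1)"
      by auto
    then have [simp]: "\<eta> = \<xi>" using inj[of \<xi> \<eta>] by simp
    have "modulus \<xi> dvd h - g" using dvd_diff[OF *(5) *(6)[simplified]] by simp
    then show "((\<xi>, g), (\<eta>, h)) \<in> gen_act (Vert v)" using * first by simp
  next
    fix \<xi> g \<eta> h assume "((\<xi>, g), (\<eta>, h)) \<in> gen_act (Vert v)"
    then have *: "\<xi> \<in> rays" "\<xi> 0 = Edge e" "\<eta> = \<xi>" "modulus \<xi> dvd h - g" using first by auto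
    then have "((\<xi>, g), (\<xi> \<circ> Suc, h + 1)) \<in> gen_act (Edge e)" "((\<xi> \<circ> Suc, h + 1), (\<eta>, h)) \<in> gen_act (Star e)"
      by auto
    then show "((\<xi>, g), (\<eta>, h)) \<in> gen_act (Edge e) O gen_act (Star e)" by blast
  qed
  then show "(Some [Edge e, Star e], Some [Vert v]) \<in> kernel"
    using e assms(1) by (simp del: gen_act.simps add: kernel_def word0_act_def)
qed

lemma ray_on_cycle:
  assumes c: "c \<in> cycles_in G W" and \<xi>: "\<xi> \<in> rays" "gsource (\<xi> 0) = path_source G c"
  shows "\<xi> i = Edge (c ! (i mod length c))"
proof (induction i)
  have n: "length c > 0" using cyclesD(2)[OF c] by simp
  have step: "\<xi> i = Edge (c ! (i mod length c))" if "gsource (\<xi> i) = tail G (c ! (i mod length c))" for i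
  proof -
    let ?e = "c ! (i mod length c)"
    have e: "?e \<in> set c" using n by simp
    then have "tail G ?e \<in> W" "?e \<in> out_arcs G (tail G ?e)"
      using cyclesD(4)[OF c] awalkD(1)[OF cyclesD(5)[OF c]] by auto
    then show ?thesis using raysD(4)[OF \<xi>(1), of i] that W_out_arc by auto
  qed
  {
    case 0
    show ?case using step[of 0] \<xi>(2) cyclesD(2)[OF c] by (simp add: hd_conv_nth)
  next
    case (Suc i)
    then show ?case using step[of "Suc i"] raysD(1)[OF \<xi>(1), of i] cycle_step[OF c, of i] by simp
  }
qed

text \<open>Only rotations of c can occur periodically in this ray, and they have the same length
  and the same value of f. So the set in \<open>modulus\<close> has one element if f(c) is finite;
  otherwise it is empty, with \<open>Gcd\<close> equal to 0.\<close>

lemma modulus_on_cycle: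
  assumes c: "c \<in> cycles_in G W" and \<xi>: "\<xi> \<in> rays" "gsource (\<xi> 0) = path_source G c"
  shows "modulus \<xi> = (case f c of enat m \<Rightarrow> int (m * length c) | \<infinity> \<Rightarrow> 0)"
proof -
  note ray = ray_on_cycle[OF assms]
  have self: "periodic_from 0 c \<xi>" using ray by (simp add: periodic_from_def)
  have rot: "length c' = length c \<and> f c' = f c" if c': "c' \<in> cycles_in G W" and k: "periodic_from k c' \<xi>" for c' k
  proof -
    have n: "length c > 0" "length c' > 0" using cyclesD(2) c c' by auto
    have eq: "c' ! (i mod length c') = c ! ((k + i) mod length c)" for i
      using k ray[of "k + i"] by (simp add: periodic_from_def)
    \<comment> \<open>The edges of a cycle are distinct, so entries determine indices modulo the
      length. Comparing one full turn of either cycle then shows that each length divides the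
      other.\<close>
    have inj: "(i mod length d = j mod length d) = (d ! (i mod length d) = d ! (j mod length d))"
      if "d \<in> cycles_in G W" for d i j
      using nth_eq_iff_index_eq[OF cyclesD(3)[OF that]] cyclesD(2)[OF that] by simp
    have "(k + length c') mod length c = (k + 0) mod length c"
      unfolding inj[OF c] using eq[of "length c'"] eq[of 0] by simp
    then have "length c dvd length c'"
      using mod_eq_dvd_iff_nat[of k "k + length c'" "length c"] by simp
    moreover have "length c mod length c' = 0 mod length c'"
      unfolding inj[OF c'] using eq[of "length c"] eq[of 0] by simp
    then have "length c' dvd length c" by auto
    ultimately have len: "length c' = length c" by (rule dvd_antisym[rotated])
    have "c' = rotate k c"
    proof (rule nth_equalityI)
      fix i assume "i < length c'"
      then show "c' ! i = rotate k c ! i"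
        using eq[of i] len by (simp add: nth_rotate)
    qed (simp add: len)
    then show ?thesis using f_rotate[OF c] len by simp
  qed
  have "{m * length c' | m c'. c' \<in> cycles_in G W \<and> f c' = enat m \<and> (\<exists>k. periodic_from k c' \<xi>)} =
      {m * length c | m. f c = enat m}"
    (is "?L = ?R")
  proof (intro equalityI subsetI)
    fix x assume "x \<in> ?L"
    then obtain m c' k where "x = m * length c'" "c' \<in> cycles_in G W" "f c' = enat m" "periodic_from k c' \<xi>"
      by blast
    then show "x \<in> ?R" using rot[of c' k] by auto
  next
    fix x assume "x \<in> ?R"
    then show "x \<in> ?L" using self c by blast
  qed
  then have "modulus \<xi> = int (Gcd {m * length c | m. f c = enat m})"
    unfolding modulus_def by (simp only:)
  then show ?thesis by (cases "f c") simp_all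
qed

text \<open>On a ray from s(c), which repeats c forever, c^m changes nothing except that it adds m
  times the length of c to the integer. This is trivial exactly if the modulus divides that number,
  and the length of c cancels.\<close>

lemma kernel_cycle_power_iff:
  assumes c: "c \<in> cycles_in G W"
  shows "(Some (nf (list_power m c) (path_source G c) []), Some [Vert (path_source G c)]) \<in> kernel \<longleftrightarrow>
    (case f c of enat k \<Rightarrow> k dvd m | \<infinity> \<Rightarrow> m = 0)"
proof -
  let ?v = "path_source G c" and ?n = "length c"
  define N where "N = (case f c of enat m \<Rightarrow> int (m * length c) | \<infinity> \<Rightarrow> 0)"
  note walk = cyclesD(5)[OF c]
  have n: "?n > 0" using cyclesD(2)[OF c] by simp
  have pw: "awalk ?v (list_power m c) ?v" by (rule awalk_list_power[OF walk])
  have act: "word_act (nf (list_power m c) ?v []) = {((\<xi>, g), (\<eta>, h)).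
      \<xi> \<in> rays \<and> gsource (\<xi> 0) = ?v \<and> \<eta> = \<xi> \<and> modulus \<xi> dvd h - (g + int (m * ?n))}"
  proof -
    have "(\<forall>i<m * ?n. \<xi> i = Edge (list_power m c ! i)) \<and> gsource (\<xi> (m * ?n)) = ?v \<and> \<eta> = (\<lambda>i. \<xi> (m * ?n + i))
        \<longleftrightarrow> gsource (\<xi> 0) = ?v \<and> \<eta> = \<xi>" (is "?L \<longleftrightarrow> ?R") if \<xi>: "\<xi> \<in> rays" for \<xi> \<eta>
    proof
      assume L: ?L
      \<comment> \<open>For m > 0 the source is read off the first letter. For m = 0 there is no
        letter to inspect, but the position in the range condition is then 0.\<close>
      then have v: "gsource (\<xi> 0) = ?v"
        using n c by (cases "m = 0") (auto simp: nth_list_power hd_conv_nth)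
      then show ?R using L ray_on_cycle[OF c \<xi>] by auto
    next
      assume R: ?R
      then show ?L
        using ray_on_cycle[OF c \<xi>] n by (auto simp: nth_list_power hd_conv_nth)
    qed
    then show ?thesis
      unfolding word_act_nf length_list_power by auto
  qed
  have mod: "modulus \<xi> = N" if "\<xi> \<in> rays" "gsource (\<xi> 0) = ?v" for \<xi>
    unfolding N_def by (rule modulus_on_cycle[OF c that])
  have "word_act (nf (list_power m c) ?v []) = gen_act (Vert ?v) \<longleftrightarrow> N dvd int (m * ?n)"
  proof
    assume eq: "word_act (nf (list_power m c) ?v []) = gen_act (Vert ?v)"
    obtain \<xi> where \<xi>: "\<xi> \<in> rays" "gsource (\<xi> 0) = ?v"
      using ray_exists awalkD(2)[OF walk] by blast
    then have "((\<xi>, 0), (\<xi>, int (m * ?n))) \<in> word_act (nf (list_power m c) ?v [])" unfolding act by simp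
    then have "((\<xi>, 0), (\<xi>, int (m * ?n))) \<in> gen_act (Vert ?v)" using eq by simp
    then show "N dvd int (m * ?n)" using mod[OF \<xi>] by simp
  next
    assume N: "N dvd int (m * ?n)"
    have "N dvd h - (g + int (m * ?n)) \<longleftrightarrow> N dvd h - g" for g h
      using dvd_diff_right_iff[OF N, of "h - g"] dvd_add_left_iff[OF N, of "h - (g + int (m * ?n))"]
      by (simp add: algebra_simps)
    then show "word_act (nf (list_power m c) ?v []) = gen_act (Vert ?v)"
      unfolding act using mod by auto
  qed
  also have "\<dots> \<longleftrightarrow> (case f c of enat k \<Rightarrow> k dvd m | \<infinity> \<Rightarrow> m = 0)"
    using n unfolding N_def by (cases "f c") (simp_all flip: of_nat_mult)
  finally show ?thesis
    using awalkD[OF pw] by (simp del: gen_act.simps add: kernel_def word0_act_def)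
qed

end

section \<open>The correspondence\<close>

context wf_digraph
begin

lemma semigroup_power_path:
  assumes "c \<noteq> []" "set c \<subseteq> arcs G" "m > 0"
  shows "semigroup_power (inv_mult G) (inv_path G c) m = inv_path G (list_power m c)"
proof -
  have "(inv_mult G (inv_path G c) ^^ k) (inv_path G c) = inv_path G (list_power (Suc k) c)" for k
  proof (induction k)
    case (Suc k)
    have "set (list_power (Suc k) c) \<subseteq> arcs G" using assms(2) by (induction k) auto
    then show ?case using Suc assms(1,2) by simp
  qed simp
  then show ?thesis using assms(3) by (cases m) (simp_all add: semigroup_power_def)
qed

lemma inv_word_pullback_iff:
  assumes "u \<noteq> []" "set u \<subseteq> generators G" "w \<noteq> []" "set w \<subseteq> generators G"
  shows "(inv_word G u, inv_word G w) \<in> \<rho> \<longleftrightarrow> (Some u, Some w) \<in> word_pullback G \<rho>"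
  using assms by (simp add: word_pullback_iff inv_word_def)

lemma inv_zero_pullback_iff:
  "v \<in> verts G \<Longrightarrow> (inv_vert G v, inv_zero G) \<in> \<rho> \<longleftrightarrow> (Some [Vert v], None) \<in> word_pullback G \<rho>"
  by (simp add: word_pullback_iff inv_word_def inv_zero_def)

lemma cycle_walk:
  assumes "is_cycle G c"
  shows "c \<noteq> []" "awalk (path_source G c) c (path_source G c)" "set c \<subseteq> arcs G"
    "path_source G c \<in> verts G"
  using assms awalkD[of "path_source G c" c "path_source G c"] by (simp_all add: is_cycle_iff)

lemma is_cycle_rotate:
  assumes "is_cycle G (p @ q)" "p \<noteq> []" "q \<noteq> []"
  shows "is_cycle G (q @ p)"
proof -
  have "awalk (path_source G p) (p @ q) (path_source G p)"
    using assms by (simp add: is_cycle_iff)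
  then obtain m where p: "awalk (path_source G p) p m" and q: "awalk m q (path_source G p)"
    by (auto simp: awalk_append_conv)
  then have "awalk m (q @ p) m" by (auto simp: awalk_append_conv)
  moreover have "m = path_source G q" using awalk_source[OF q assms(3)] by simp
  ultimately show ?thesis
    using assms by (auto simp: is_cycle_iff)
qed

lemma cycles_in_rotate:
  assumes "c \<in> cycles_in G W"
  shows "rotate k c \<in> cycles_in G W"
proof -
  let ?p = "take (k mod length c) c" and ?q = "drop (k mod length c) c"
  have "is_cycle G (?q @ ?p)"
  proof (cases "?p = []")
    case False
    have "k mod length c < length c" using assms by (auto simp: cycles_in_def is_cycle_iff)
    then show ?thesis using is_cycle_rotate[of ?p ?q] False assms by (simp add: cycles_in_def)
  qed (use assms in \<open>auto simp: cycles_in_def\<close>)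
  then have "is_cycle G (rotate k c)" by (simp add: rotate_drop_take)
  then show ?thesis using assms by (simp add: cycles_in_def)
qed

end

context word_congruence
begin

text \<open>The power (p q)^k is the loop p followed by q (p q)^(k-1); rotating p to the end gives
  (q p)^k.\<close>

lemma power_rotate:
  assumes "nf (list_power k (p @ q)) u [] \<approx> [Vert u]" "awalk u p m" "awalk m q u" "k > 0"
  shows "nf (list_power k (q @ p)) m [] \<approx> [Vert m]"
proof -
  obtain j where k: "k = Suc j" using assms(4) by (cases k) auto
  have w: "awalk u (p @ q) u" "awalk m (q @ p) m" using assms(2,3) by (auto simp: awalk_append_conv)
  have "awalk m (q @ list_power j (p @ q)) u"
    using awalk_list_power[OF w(1), of j] assms(3) by (auto simp: awalk_append_conv)
  then have "nf ((q @ list_power j (p @ q)) @ p) m [] \<approx> [Vert m]"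
    using loop_rotate[OF _ assms(2), of "q @ list_power j (p @ q)"] assms(1) k by simp
  moreover have "(q @ list_power j (p @ q)) @ p = list_power k (q @ p)"
  proof -
    have "(q @ list_power j (p @ q)) @ p = list_power j (q @ p) @ (q @ p)"
      using list_power_shift[of q j p] by simp
    also have "\<dots> = list_power (j + 1) (q @ p)" by (simp only: list_power_add) simp
    finally show ?thesis using k by simp
  qed
  ultimately show ?thesis by simp
qed

lemma cycle_power_eqv_iff:
  assumes c: "is_cycle G c" and m: "m > 0"
  shows "map Edge (list_power m c) \<approx> [Vert (path_source G c)] \<longleftrightarrow>
    nf (list_power m c) (path_source G c) [] \<approx> [Vert (path_source G c)]"
proof -
  have "list_power m c \<noteq> []" using cycle_walk(1)[OF c] m by (cases m) auto
  from path_absorb_right[OF awalk_list_power[OF cycle_walk(2)[OF c]] this]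
  show ?thesis using eqv_sym eqv_trans by blast
qed

end

section \<open>Congruences on Inv(G) expressed through their pullbacks to words\<close>

locale inv_congruence = wf_digraph G for G :: "('v, 'e) pre_digraph" +
  fixes \<rho> :: "(('v, 'e) inv_elem \<times> ('v, 'e) inv_elem) set"
  assumes congruence: "semigroup_congruence (inv_carrier G) (inv_mult G) \<rho>"

sublocale inv_congruence \<subseteq> word_congruence G "word_pullback G \<rho>"
  by (rule word_congruence_pullback[OF congruence])

context inv_congruence
begin

notation eqv (infix "\<approx>" 50)

lemma rho_word_iff:
  assumes "u \<noteq> []" "set u \<subseteq> generators G" "w \<noteq> []" "set w \<subseteq> generators G"
  shows "(inv_word G u, inv_word G w) \<in> \<rho> \<longleftrightarrow> u \<approx> w"
  using inv_word_pullback_iff[OF assms] by (simp add: eqv_def)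

lemma rho_collapse_iff:
  assumes "e \<in> arcs G" "v \<in> verts G"
  shows "(inv_mult G (inv_edge G e) (inv_star G e), inv_vert G v) \<in> \<rho> \<longleftrightarrow> [Edge e, Star e] \<approx> [Vert v]"
  using assms by (simp add: rho_word_iff)

lemma cong_verts_eq: "cong_verts G \<rho> = collapsed"
  unfolding cong_verts_def collapsed_def
  using rho_collapse_iff by (intro Collect_cong conj_cong bex_cong) auto

definition trivial_power :: "'e list \<Rightarrow> nat \<Rightarrow> bool" where
  "trivial_power c m \<longleftrightarrow> m > 0 \<and> nf (list_power m c) (path_source G c) [] \<approx> [Vert (path_source G c)]"

lemma rho_power_iff:
  assumes c: "is_cycle G c" and m: "m > 0"
  shows "(semigroup_power (inv_mult G) (inv_path G c) m, inv_vert G (path_source G c)) \<in> \<rho>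
    \<longleftrightarrow> trivial_power c m"
proof -
  note w = cycle_walk[OF c]
  have "set (list_power m c) \<subseteq> arcs G" "list_power m c \<noteq> []" using w m by auto
  then have "(inv_path G (list_power m c), inv_vert G (path_source G c)) \<in> \<rho> \<longleftrightarrow>
      map Edge (list_power m c) \<approx> [Vert (path_source G c)]"
    using w by (intro rho_word_iff) auto
  then show ?thesis
    using cycle_power_eqv_iff[OF c m] semigroup_power_path[OF w(1,3) m] m
    by (simp add: trivial_power_def)
qed

lemma cycle_order_eq:
  assumes "is_cycle G c"
  shows "cycle_order G \<rho> c = (if \<exists>m. trivial_power c m then enat (LEAST m. trivial_power c m) else \<infinity>)"
proof -
  have "(m > 0 \<and> (semigroup_power (inv_mult G) (inv_path G c) m, inv_vert G (path_source G c)) \<in> \<rho>)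
      \<longleftrightarrow> trivial_power c m" for m
    using rho_power_iff[OF assms] by (auto simp: trivial_power_def)
  then show ?thesis by (simp add: cycle_order_def Let_def)
qed

lemma cycle_order_enat:
  assumes "is_cycle G c" "cycle_order G \<rho> c = enat m"
  shows "trivial_power c m"
  using assms(2) LeastI_ex[of "trivial_power c"] unfolding cycle_order_eq[OF assms(1)]
  by (auto split: if_splits)

lemma cycle_order_nonzero: "is_cycle G c \<Longrightarrow> cycle_order G \<rho> c \<noteq> 0"
  using cycle_order_enat[of c 0] by (auto simp: zero_enat_def trivial_power_def)

text \<open>Applied in both directions, \<open>power_rotate\<close> shows that c and its rotation
  have the same trivial exponents, hence the same least one.\<close>

lemma cycle_order_rotate:
  assumes c: "is_cycle G c"
  shows "cycle_order G \<rho> (rotate k c) = cycle_order G \<rho> c"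
proof -
  let ?p = "take (k mod length c) c" and ?q = "drop (k mod length c) c"
  have rot: "rotate k c = ?q @ ?p" by (rule rotate_drop_take)
  show ?thesis
  proof (cases "?p = []")
    case False
    have "k mod length c < length c" using cycle_walk(1)[OF c] by simp
    then have q: "?q \<noteq> []" by simp
    let ?u = "path_source G c"
    have "awalk ?u (?p @ ?q) ?u" using cycle_walk(2)[OF c] by simp
    then obtain m where pw: "awalk ?u ?p m" and qw: "awalk m ?q ?u"
      unfolding awalk_append_conv by blast
    have m: "m = path_source G (?q @ ?p)" using awalk_source[OF qw q] q by simp
    have "trivial_power (?q @ ?p) j \<longleftrightarrow> trivial_power c j" for j
      using power_rotate[OF _ pw qw, of j] power_rotate[OF _ qw pw, of j]
      unfolding trivial_power_def m[symmetric] append_take_drop_id by blast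
    then have "trivial_power (?q @ ?p) = trivial_power c" ..
    moreover have "is_cycle G (?q @ ?p)"
      using is_cycle_rotate[of ?p ?q] c False q by simp
    ultimately show ?thesis
      unfolding rot using cycle_order_eq c by simp
  next
    case True
    then have "?q = c"
      using append_take_drop_id[of "k mod length c" c] by (simp only: append_Nil)
    then show ?thesis unfolding rot True by simp
  qed
qed

end

section \<open>The two mappings and their compositions\<close>

definition pair_relations ::
    "('v, 'e) pre_digraph \<Rightarrow> 'v set \<Rightarrow> ('e list \<Rightarrow> enat) \<Rightarrow> (('v, 'e) inv_elem \<times> ('v, 'e) inv_elem) set" where
  "pair_relations G W f =
     {(inv_mult G (inv_edge G (the_out_arc G v)) (inv_star G (the_out_arc G v)), inv_vert G v) | v. v \<in> W} \<union>
     {(semigroup_power (inv_mult G) (inv_path G c) m, inv_vert G (path_source G c))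
        | c m. c \<in> cycles_in G W \<and> f c = enat m}"

context wf_digraph
begin

lemma inv_congruenceI: "\<rho> \<in> special_congruences G \<Longrightarrow> inv_congruence G \<rho>"
  by unfold_locales (simp add: special_congruences_def)

lemma special_word_congruenceI:
  assumes "\<rho> \<in> special_congruences G"
  shows "special_word_congruence G (word_pullback G \<rho>)"
proof -
  interpret inv_congruence G \<rho> by (rule inv_congruenceI[OF assms])
  show ?thesis
    using assms by unfold_locales (simp add: special_congruences_def vanishes_def inv_zero_pullback_iff)
qed

lemma map_T_congruence_pair:
  assumes \<rho>: "\<rho> \<in> special_congruences G"
  shows "map_T G \<rho> \<in> congruence_pairs G"
proof -
  interpret inv_congruence G \<rho> by (rule inv_congruenceI[OF \<rho>])
  interpret special_word_congruence G "word_pullback G \<rho>" by (rule special_word_congruenceI[OF \<rho>])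
  have "restrict (cycle_order G \<rho>) (cycles_in G collapsed) \<in> cycle_functions G collapsed"
    using cycle_order_nonzero cycle_order_rotate cycles_in_rotate
    by (auto simp: cycle_functions_def) (auto simp: cycles_in_def)
  then show ?thesis
    using collapsed_index_one by (simp add: map_T_def cong_verts_eq congruence_pairs_def Let_def)
qed

lemma map_wp_eq: "map_wp G (W, f) = generated_congruence (inv_carrier G) (inv_mult G) (pair_relations G W f)"
  by (simp add: map_wp_def pair_relations_def)

end

context congruence_pair
begin

text \<open>A test on words for containing wp(W, f). It is applied to the kernel, to bound wp(W, f)
  from above, and to a special congruence with this pair.\<close>

lemma pair_relations_subset:
  assumes "semigroup_congruence (inv_carrier G) (inv_mult G) \<rho>"
    and collapse: "\<And>v. v \<in> W \<Longrightarrow>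
      (Some [Edge (the_out_arc G v), Star (the_out_arc G v)], Some [Vert v]) \<in> word_pullback G \<rho>"
    and power: "\<And>c m. c \<in> cycles_in G W \<Longrightarrow> f c = enat m \<Longrightarrow>
      (Some (nf (list_power m c) (path_source G c) []), Some [Vert (path_source G c)]) \<in> word_pullback G \<rho>"
  shows "pair_relations G W f \<subseteq> \<rho>"
proof -
  interpret inv_congruence G \<rho> by unfold_locales (rule assms(1))
  have "v \<in> verts G" if "v \<in> W" for v using that W by (auto simp: index_one_verts_def)
  then have "(inv_mult G (inv_edge G (the_out_arc G v)) (inv_star G (the_out_arc G v)), inv_vert G v) \<in> \<rho>"
    if "v \<in> W" for v
    using that rho_collapse_iff collapse the_out_arc_W by (simp add: eqv_def)
  moreover have "(semigroup_power (inv_mult G) (inv_path G c) m, inv_vert G (path_source G c)) \<in> \<rho>"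
    if "c \<in> cycles_in G W" "f c = enat m" for c m
  proof -
    have "m > 0" using f_nonzero[OF that(1)] that(2) by (cases m) (auto simp: zero_enat_def)
    then show ?thesis
      using rho_power_iff[OF cyclesD(1)[OF that(1)]] power[OF that] by (simp add: trivial_power_def eqv_def)
  qed
  ultimately show ?thesis unfolding pair_relations_def by blast
qed

lemma pushforward_kernel:
  shows "semigroup_congruence (inv_carrier G) (inv_mult G) (word_pushforward G kernel)"
    and "word_pullback G (word_pushforward G kernel) = kernel"
proof -
  note push = semigroup_congruence_pushforward[OF word_congruence_kernel]
  show "semigroup_congruence (inv_carrier G) (inv_mult G) (word_pushforward G kernel)" by (rule push(1))
  have "kernel \<subseteq> words0 G \<times> words0 G" by (auto simp: kernel_def)
  then show "word_pullback G (word_pushforward G kernel) = kernel"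
    using push(2) by (auto simp: word_pullback_iff)
qed

text \<open>One inclusion serves twice: the kernel bounds wp(W, f), and, being a relation on the
  carrier, it shows that the generating pairs lie there, so that they do generate a
  congruence.\<close>

lemma pair_relations_carrier: "pair_relations G W f \<subseteq> inv_carrier G \<times> inv_carrier G"
  and map_wp_subset_kernel: "map_wp G (W, f) \<subseteq> word_pushforward G kernel"
proof -
  have *: "pair_relations G W f \<subseteq> word_pushforward G kernel"
  proof (rule pair_relations_subset[OF pushforward_kernel(1)]; unfold pushforward_kernel(2))
    fix v assume v: "v \<in> W"
    then have "v \<in> verts G" "the_out_arc G v \<in> out_arcs G v"
      using W the_out_arc_W by (auto simp: index_one_verts_def)
    then show "(Some [Edge (the_out_arc G v), Star (the_out_arc G v)], Some [Vert v]) \<in> kernel"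
      using kernel_collapse_iff v by blast
  next
    fix c m assume "c \<in> cycles_in G W" "f c = enat m"
    then show "(Some (nf (list_power m c) (path_source G c) []), Some [Vert (path_source G c)]) \<in> kernel"
      using kernel_cycle_power_iff[of c m] by simp
  qed
  then show "map_wp G (W, f) \<subseteq> word_pushforward G kernel"
    unfolding map_wp_eq by (intro generated_congruence_least pushforward_kernel(1))
  show "pair_relations G W f \<subseteq> inv_carrier G \<times> inv_carrier G"
    using * equiv_type[OF semigroup_congruenceD(1)[OF pushforward_kernel(1)]] by blast
qed

lemma map_wp_congruence: "inv_congruence G (map_wp G (W, f))"
  unfolding map_wp_eq
  by unfold_locales (intro semigroup_congruence_generated inv_mult_closed pair_relations_carrier)

lemma map_wp_pullback_subset: "word_pullback G (map_wp G (W, f)) \<subseteq> kernel"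
  using map_wp_subset_kernel pushforward_kernel(2) by (auto simp: word_pullback_def)

lemma map_wp_special: "map_wp G (W, f) \<in> special_congruences G"
proof -
  interpret inv_congruence G "map_wp G (W, f)" by (rule map_wp_congruence)
  show ?thesis
    using congruence kernel_vertex map_wp_pullback_subset
    by (auto simp: special_congruences_def inv_zero_pullback_iff)
qed

text \<open>The generators show that at least W and the finite exponents f(c) are recovered. The
  kernel shows that nothing more is: a collapsed vertex lies in W, and a trivial exponent is a
  positive multiple of f(c), which is impossible for f(c) infinite.\<close>

lemma map_T_map_wp: "map_T G (map_wp G (W, f)) = (W, f)"
proof -
  interpret inv_congruence G "map_wp G (W, f)" by (rule map_wp_congruence)
  have rel: "pair_relations G W f \<subseteq> map_wp G (W, f)"
    unfolding map_wp_eq by (rule generated_congruence_superset)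
  have "collapsed = W"
  proof (intro equalityI subsetI)
    fix v assume "v \<in> collapsed"
    then obtain e where "v \<in> verts G" "e \<in> out_arcs G v" "eqv [Edge e, Star e] [Vert v]"
      by (auto simp: collapsed_def)
    then show "v \<in> W"
      using kernel_collapse_iff map_wp_pullback_subset unfolding eqv_def by blast
  next
    fix v assume v: "v \<in> W"
    then have "(inv_mult G (inv_edge G (the_out_arc G v)) (inv_star G (the_out_arc G v)), inv_vert G v)
        \<in> map_wp G (W, f)"
      using rel unfolding pair_relations_def by blast
    moreover have vG: "v \<in> verts G" and "the_out_arc G v \<in> out_arcs G v"
      using W the_out_arc_W v by (auto simp: index_one_verts_def)
    moreover have "the_out_arc G v \<in> arcs G" by (rule the_out_arc_W(1)[OF v])
    ultimately show "v \<in> collapsed"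
      using rho_collapse_iff unfolding collapsed_def by blast
  qed
  then have verts: "cong_verts G (map_wp G (W, f)) = W" by (simp add: cong_verts_eq)
  have order: "cycle_order G (map_wp G (W, f)) c = f c" if c: "c \<in> cycles_in G W" for c
  proof -
    note cyc = cyclesD(1)[OF c]
    have ker: "m > 0" "case f c of enat k \<Rightarrow> k dvd m | \<infinity> \<Rightarrow> m = 0" if "trivial_power c m" for m
    proof -
      show "m > 0" using that by (simp add: trivial_power_def)
      have "(Some (nf (list_power m c) (path_source G c) []), Some [Vert (path_source G c)]) \<in> kernel"
        using that map_wp_pullback_subset unfolding trivial_power_def eqv_def by blast
      then show "case f c of enat k \<Rightarrow> k dvd m | \<infinity> \<Rightarrow> m = 0"
        unfolding kernel_cycle_power_iff[OF c] .
    qed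
    show ?thesis
    proof (cases "f c")
      case (enat k)
      then have k: "k > 0" using f_nonzero[OF c] by (cases k) (auto simp: zero_enat_def)
      have "(semigroup_power (inv_mult G) (inv_path G c) k, inv_vert G (path_source G c)) \<in> map_wp G (W, f)"
        using rel c enat unfolding pair_relations_def by blast
      then have triv: "trivial_power c k" using rho_power_iff[OF cyc k] by simp
      have "k \<le> m" if "trivial_power c m" for m
        using ker[OF that] enat by (simp add: dvd_imp_le)
      then have "(LEAST m. trivial_power c m) = k"
        using triv by (intro Least_equality)
      then show ?thesis unfolding cycle_order_eq[OF cyc] using triv enat by auto
    next
      case infinity
      then have "\<not> trivial_power c m" for m using ker[of m] by auto
      then show ?thesis unfolding cycle_order_eq[OF cyc] using infinity by simp
    qed
  qed
  have "restrict (cycle_order G (map_wp G (W, f))) (cycles_in G W) = f"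
    using order f_extensional by (intro extensionalityI[of _ "cycles_in G W"]) auto
  then show ?thesis by (simp add: map_T_def verts)
qed

end

text \<open>The generators of wp(T(rho)) hold in rho by the definition of T. Conversely they supply
  what \<open>two_word_congruences\<close> asks of its second congruence, so rho is contained in
  wp(T(rho)).\<close>

lemma (in wf_digraph) map_wp_map_T:
  assumes \<rho>: "\<rho> \<in> special_congruences G"
  shows "map_wp G (map_T G \<rho>) = \<rho>"
proof -
  interpret A: inv_congruence G \<rho> by (rule inv_congruenceI[OF \<rho>])
  interpret A: special_word_congruence G "word_pullback G \<rho>" by (rule special_word_congruenceI[OF \<rho>])
  define W where "W = cong_verts G \<rho>"
  define f where "f = restrict (cycle_order G \<rho>) (cycles_in G W)"
  have T: "map_T G \<rho> = (W, f)" by (simp add: map_T_def W_def f_def Let_def)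
  have W_eq: "W = A.collapsed" by (simp add: W_def A.cong_verts_eq)
  interpret congruence_pair G W f
    using map_T_congruence_pair[OF \<rho>] T by unfold_locales simp
  interpret B: inv_congruence G "map_wp G (W, f)" by (rule map_wp_congruence)
  have rel: "pair_relations G W f \<subseteq> map_wp G (W, f)"
    unfolding map_wp_eq by (rule generated_congruence_superset)
  have "pair_relations G W f \<subseteq> \<rho>"
  proof (rule pair_relations_subset[OF A.congruence])
    fix v assume "v \<in> W"
    then show "(Some [Edge (the_out_arc G v), Star (the_out_arc G v)], Some [Vert v]) \<in> word_pullback G \<rho>"
      using A.collapsed_unique(1)[of v "the_out_arc G v"] the_out_arc_W W_eq by (simp add: A.eqv_def)
  next
    fix c m assume c: "c \<in> cycles_in G W" "f c = enat m"
    then have "A.trivial_power c m"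
      using A.cycle_order_enat[OF cyclesD(1)[OF c(1)]] by (simp add: f_def)
    then show "(Some (nf (list_power m c) (path_source G c) []), Some [Vert (path_source G c)]) \<in> word_pullback G \<rho>"
      by (simp add: A.trivial_power_def A.eqv_def)
  qed
  then have "map_wp G (W, f) \<subseteq> \<rho>"
    unfolding map_wp_eq by (intro generated_congruence_least A.congruence)
  moreover have "\<rho> \<subseteq> map_wp G (W, f)"
  proof -
    interpret two_word_congruences G "word_pullback G \<rho>" "word_pullback G (map_wp G (W, f))"
    proof unfold_locales
      fix e assume e: "e \<in> arcs G" "A.eqv [Edge e, Star e] [Vert (tail G e)]"
      then have v: "tail G e \<in> W" unfolding W_eq A.collapsed_def by auto
      then have "the_out_arc G (tail G e) = e" using e(1) W_out_arc[OF v] by (metis in_out_arcs_conv singletonD)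
      moreover have "(inv_mult G (inv_edge G (the_out_arc G (tail G e))) (inv_star G (the_out_arc G (tail G e))),
          inv_vert G (tail G e)) \<in> map_wp G (W, f)"
        using rel v unfolding pair_relations_def by blast
      ultimately have "(inv_mult G (inv_edge G e) (inv_star G e), inv_vert G (tail G e)) \<in> map_wp G (W, f)"
        by (simp only:)
      then show "B.eqv [Edge e, Star e] [Vert (tail G e)]"
        using B.rho_collapse_iff[of e "tail G e"] e(1) by simp
    next
      fix c m assume c: "is_cycle G c" "tail G ` set c \<subseteq> A.collapsed" and m: "0 < m"
        and triv: "A.eqv (nf (list_power m c) (path_source G c) []) [Vert (path_source G c)]"
        and least: "\<And>k. 0 < k \<Longrightarrow> k < m \<Longrightarrow>
          \<not> A.eqv (nf (list_power k c) (path_source G c) []) [Vert (path_source G c)]"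
      have cW: "c \<in> cycles_in G W" using c W_eq by (simp add: cycles_in_def)
      have P: "A.trivial_power c m" using m triv by (simp add: A.trivial_power_def)
      have "m \<le> k" if "A.trivial_power c k" for k
        using that least[of k] unfolding A.trivial_power_def by (meson not_le)
      then have "(LEAST m. A.trivial_power c m) = m"
        using P by (intro Least_equality)
      then have "cycle_order G \<rho> c = enat m"
        unfolding A.cycle_order_eq[OF c(1)] using P by (simp only: if_P exI)
      then have "f c = enat m" using cW by (simp add: f_def)
      then have "(semigroup_power (inv_mult G) (inv_path G c) m, inv_vert G (path_source G c)) \<in> map_wp G (W, f)"
        using rel cW unfolding pair_relations_def by blast
      then show "B.eqv (nf (list_power m c) (path_source G c) []) [Vert (path_source G c)]"
        using B.rho_power_iff[OF c(1) m] by (simp add: B.trivial_power_def)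
    qed
    show ?thesis
    proof
      fix z assume z: "z \<in> \<rho>"
      have "\<rho> \<subseteq> inv_carrier G \<times> inv_carrier G"
        by (rule equiv_type[OF semigroup_congruenceD(1)[OF A.congruence]])
      then obtain X Y where XY: "z = (X, Y)" "X \<in> inv_carrier G" "Y \<in> inv_carrier G"
        using z by (cases z) blast
      obtain x where x: "x \<in> words0 G" "X = inv_class G x" using XY(2) by (rule inv_carrierE)
      obtain y where y: "y \<in> words0 G" "Y = inv_class G y" using XY(3) by (rule inv_carrierE)
      have "(x, y) \<in> word_pullback G \<rho>" using z XY x y by (simp add: word_pullback_iff)
      then have "(x, y) \<in> word_pullback G (map_wp G (W, f))" using congruence_subset by blast
      then show "z \<in> map_wp G (W, f)" using XY x y by (simp add: word_pullback_iff)
    qed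
  qed
  ultimately show ?thesis unfolding T by blast
qed

theorem theorem1p3:
  fixes G :: "('v, 'e) pre_digraph"
  assumes "wf_digraph G"
  shows "map_T G \<in> special_congruences G \<rightarrow> congruence_pairs G \<and>
         map_wp G \<in> congruence_pairs G \<rightarrow> special_congruences G \<and>
         (\<forall>\<rho>\<in>special_congruences G. map_wp G (map_T G \<rho>) = \<rho>) \<and>
         (\<forall>p\<in>congruence_pairs G. map_T G (map_wp G p) = p) \<and>
         bij_betw (map_T G) (special_congruences G) (congruence_pairs G)"
proof -
  interpret wf_digraph G by fact
  have pair: "congruence_pair G (fst p) (snd p)" if "p \<in> congruence_pairs G" for p
    using that by unfold_locales simp
  have wp: "map_wp G p \<in> special_congruences G" "map_T G (map_wp G p) = p" if "p \<in> congruence_pairs G" for p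
    using congruence_pair.map_wp_special[OF pair[OF that]] congruence_pair.map_T_map_wp[OF pair[OF that]]
    by simp_all
  have "bij_betw (map_T G) (special_congruences G) (congruence_pairs G)"
    using map_T_congruence_pair map_wp_map_T wp
    by (intro bij_betw_byWitness[where f' = "map_wp G"]) auto
  then show ?thesis using map_T_congruence_pair map_wp_map_T wp by auto
qed

end
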